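(* Let $G=(V,E)$ be a graph, let $\omega:E\to\mathbb{Q}$ be an edge-weight function, let $\chi$ be a $c$-coloring of $G$, and let $S\subseteq V$ be a set of size at most $k$. One can compute in $O(3^k\cdot c\cdot k^2+k\cdot\Delta(G))$ time a $c$-coloring $\chi'$ of $G$ such that $D_{\mathrm{flip}}(\chi,\chi')\subseteq S$ and $\omega(E(\chi'))$ is maximal among all $c$-colorings with this property.
   Context: A $c$-coloring is a function $V\to\{1,\dots,c\}$. $D_{\mathrm{flip}}(\chi,\chi')=\{v\in V:\chi(v)\neq\chi'(v)\}$. $E(\chi)=\{\{u,v\}\in E:\chi(u)\neq\chi(v)\}$ and $\omega(F)$ is the total weight of an edge set $F$. $\Delta(G)$ is the maximum degree of $G$. *)

theory Defs
  imports Complex_Main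
begin

section \<open>Graphs and colorings\<close>

definition graph :: "'v set \<Rightarrow> 'v set set \<Rightarrow> bool" where
  "graph V E \<longleftrightarrow> finite V \<and> (\<forall>e\<in>E. e \<subseteq> V \<and> card e = 2)"

definition neighbours :: "'v set set \<Rightarrow> 'v \<Rightarrow> 'v set" where
  "neighbours E v = {u. {u, v} \<in> E}"

definition degree :: "'v set set \<Rightarrow> 'v \<Rightarrow> nat" where
  "degree E v = card (neighbours E v)"

text \<open>The inserted \<open>0\<close> only matters for the graph without vertices.\<close>

definition max_degree :: "'v set \<Rightarrow> 'v set set \<Rightarrow> nat" where
  "max_degree V E = Max (insert 0 (degree E ` V))"

text \<open>Only the values of \<open>\<chi>\<close> on \<open>V\<close> are relevant here and below.\<close>

definition coloring :: "'v set \<Rightarrow> nat \<Rightarrow> ('v \<Rightarrow> nat) \<Rightarrow> bool" where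
  "coloring V c \<chi> \<longleftrightarrow> (\<forall>v\<in>V. \<chi> v \<in> {1..c})"

definition D_flip :: "'v set \<Rightarrow> ('v \<Rightarrow> nat) \<Rightarrow> ('v \<Rightarrow> nat) \<Rightarrow> 'v set" where
  "D_flip V \<chi> \<chi>' = {v \<in> V. \<chi> v \<noteq> \<chi>' v}"

definition cut_edges :: "'v set set \<Rightarrow> ('v \<Rightarrow> nat) \<Rightarrow> 'v set set" where
  "cut_edges E \<chi> = {e \<in> E. \<exists>u v. e = {u, v} \<and> \<chi> u \<noteq> \<chi> v}"

definition weight :: "('v set \<Rightarrow> rat) \<Rightarrow> 'v set set \<Rightarrow> rat" where
  "weight \<omega> F = (\<Sum>e\<in>F. \<omega> e)"

section \<open>A random access machine\<close>

text \<open>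
  Programs are while-programs over finitely many named, unbounded arrays that hold natural
  numbers or rational numbers; a scalar is the cell of an array at a constant index.
  The only arithmetic operations are addition and (on natural numbers, truncated) subtraction.
  Multiplication is left out on purpose: as a unit-cost operation it would allow repeated
  squaring. There is no conversion between the two sorts of numbers.
\<close>

type_synonym vname = string

datatype nexp =
    NConst nat
  | NRead vname nexp
  | NPlus nexp nexp
  | NMinus nexp nexp

datatype rexp =
    RConst rat
  | RRead vname nexp
  | RPlus rexp rexp
  | RMinus rexp rexp

datatype bexp =
    NLess nexp nexp
  | RLess rexp rexp
  | BNot bexp
  | BAnd bexp bexp

datatype com =
    Skip
  | NWrite vname nexp nexp
  | RWrite vname nexp rexp
  | Seq com com
  | If bexp com com
  | While bexp com

record state =
  nmem :: "vname \<Rightarrow> nat \<Rightarrow> nat"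
  rmem :: "vname \<Rightarrow> nat \<Rightarrow> rat"

fun nval :: "nexp \<Rightarrow> state \<Rightarrow> nat" where
  "nval (NConst n) s = n"
| "nval (NRead x e) s = nmem s x (nval e s)"
| "nval (NPlus e f) s = nval e s + nval f s"
| "nval (NMinus e f) s = nval e s - nval f s"

fun rval :: "rexp \<Rightarrow> state \<Rightarrow> rat" where
  "rval (RConst q) s = q"
| "rval (RRead x e) s = rmem s x (nval e s)"
| "rval (RPlus e f) s = rval e s + rval f s"
| "rval (RMinus e f) s = rval e s - rval f s"

fun bval :: "bexp \<Rightarrow> state \<Rightarrow> bool" where
  "bval (NLess e f) s \<longleftrightarrow> nval e s < nval f s"
| "bval (RLess e f) s \<longleftrightarrow> rval e s < rval f s"
| "bval (BNot b) s \<longleftrightarrow> \<not> bval b s"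
| "bval (BAnd b b') s \<longleftrightarrow> bval b s \<and> bval b' s"

definition nwrite :: "vname \<Rightarrow> nat \<Rightarrow> nat \<Rightarrow> state \<Rightarrow> state" where
  "nwrite x i n s = s\<lparr>nmem := (nmem s)(x := (nmem s x)(i := n))\<rparr>"

definition rwrite :: "vname \<Rightarrow> nat \<Rightarrow> rat \<Rightarrow> state \<Rightarrow> state" where
  "rwrite x i q s = s\<lparr>rmem := (rmem s)(x := (rmem s x)(i := q))\<rparr>"

text \<open>
  \<open>exec P s t s'\<close>: started in \<open>s\<close>, the program \<open>P\<close> halts in \<open>s'\<close> after \<open>t\<close> steps.
  Each executed assignment and each evaluated test costs one step. The expressions of a program
  have constant size, so charging for every operation in them would change the
  running time of a program by a constant factor only.
\<close>

inductive exec :: "com \<Rightarrow> state \<Rightarrow> nat \<Rightarrow> state \<Rightarrow> bool" where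
  Skip: "exec Skip s 1 s"
| NWrite: "exec (NWrite x e f) s 1 (nwrite x (nval e s) (nval f s) s)"
| RWrite: "exec (RWrite x e f) s 1 (rwrite x (nval e s) (rval f s) s)"
| Seq: "exec P s t s' \<Longrightarrow> exec Q s' t' s'' \<Longrightarrow> exec (Seq P Q) s (t + t') s''"
| IfTrue: "bval b s \<Longrightarrow> exec P s t s' \<Longrightarrow> exec (If b P Q) s (1 + t) s'"
| IfFalse: "\<not> bval b s \<Longrightarrow> exec Q s t s' \<Longrightarrow> exec (If b P Q) s (1 + t) s'"
| WhileFalse: "\<not> bval b s \<Longrightarrow> exec (While b P) s 1 s"
| WhileTrue: "bval b s \<Longrightarrow> exec P s t s' \<Longrightarrow> exec (While b P) s' t' s'' \<Longrightarrow>
    exec (While b P) s (1 + t + t') s''"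

lemma exec_deterministic:
  "exec P s t s' \<Longrightarrow> exec P s u r \<Longrightarrow> u = t \<and> r = s'"
proof (induction arbitrary: u r rule: exec.induct)
  case (Seq P s t s' Q t' s'')
  from Seq.prems show ?case
    by cases (use Seq.IH in metis)
next
  case (IfTrue b s P t s' Q)
  from IfTrue.prems show ?case
    by cases (use IfTrue.hyps(1) IfTrue.IH in metis)+
next
  case (IfFalse b s Q t s' P)
  from IfFalse.prems show ?case
    by cases (use IfFalse.hyps(1) IfFalse.IH in metis)+
next
  case (WhileFalse b s P)
  from WhileFalse.prems show ?case
    by cases (use WhileFalse.hyps(1) in simp_all)
next
  case (WhileTrue b s P t s' t' s'')
  from WhileTrue.prems show ?case
    by cases (use WhileTrue.hyps(1) WhileTrue.IH in metis)+
qed (auto elim: exec.cases)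

section \<open>Encoding of instances\<close>

text \<open>
  Vertices are natural numbers, so that they can be used as array indices.
  The neighbours of \<open>v\<close> and the weights of the corresponding edges are listed, in any order,
  in the arrays \<open>adj\<close> and \<open>wt\<close> at the addresses \<open>start v, \<dots>, start v + deg v - 1\<close>.
  All arrays that do not belong to the input are initially zero.
  Since the running time does not depend on \<open>card V\<close>, the new coloring has to be left in
  the array \<open>col\<close> that holds the given coloring initially.
\<close>

definition input_arrays :: "vname set" where
  "input_arrays = {''n'', ''V'', ''deg'', ''start'', ''adj'', ''c'', ''col'', ''size'', ''S''}"

definition encodes ::
  "state \<Rightarrow> nat set \<Rightarrow> nat set set \<Rightarrow> (nat set \<Rightarrow> rat) \<Rightarrow> nat \<Rightarrow> (nat \<Rightarrow> nat) \<Rightarrow> nat set \<Rightarrow> bool" where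
  "encodes s V E \<omega> c \<chi> S \<longleftrightarrow>
    nmem s ''n'' 0 = card V \<and>
    bij_betw (nmem s ''V'') {..<card V} V \<and>
    (\<forall>v\<in>V.
      nmem s ''deg'' v = degree E v \<and>
      bij_betw (\<lambda>p. nmem s ''adj'' (nmem s ''start'' v + p)) {..<degree E v} (neighbours E v) \<and>
      (\<forall>p<degree E v. rmem s ''wt'' (nmem s ''start'' v + p) =
        \<omega> {v, nmem s ''adj'' (nmem s ''start'' v + p)})) \<and>
    nmem s ''c'' 0 = c \<and>
    (\<forall>v\<in>V. nmem s ''col'' v = \<chi> v) \<and>
    nmem s ''size'' 0 = card S \<and>
    bij_betw (nmem s ''S'') {..<card S} S \<and>
    (\<forall>x. x \<notin> input_arrays \<longrightarrow> nmem s x = (\<lambda>_. 0)) \<and>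
    (\<forall>x. x \<noteq> ''wt'' \<longrightarrow> rmem s x = (\<lambda>_. 0))"

definition output_coloring :: "state \<Rightarrow> nat \<Rightarrow> nat" where
  "output_coloring s = nmem s ''col''"

end

theory Submission
  imports Defs "HOL-Library.Nat_Bijection"
begin

text \<open>
  Maximizing the weight of the cut is minimizing the weight of the monochromatic edges that meet
  \<open>S\<close>. Charging such an edge to its endpoint in \<open>S\<close> of larger index splits this weight as
  \<open>\<Sum>i. class_cost i (A i)\<close>, where \<open>A i\<close> is the set of vertices of \<open>S\<close> of color \<open>i\<close>. The optimum over
  all ordered partitions of \<open>S\<close> is found color by color:
  \<open>T i X\<close> is the minimum of \<open>T (i - 1) (X - B) + class_cost i B\<close> over all \<open>B \<subseteq> X\<close>, so each color costs one
  step for every pair of disjoint subsets of \<open>S\<close>, that is \<open>3 ^ card S\<close> steps.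

  The machine has neither multiplication nor bit operations. Subsets of \<open>S\<close> are therefore stored as
  sums of powers of two, and every table indexed by subsets (the list of disjoint pairs, the costs)
  is built by adding one vertex at a time and copying what is there already.
\<close>

section \<open>Verifying running programs\<close>

text \<open>The time bound does not mention \<open>card V\<close>, so nothing may scan or copy the
  coloring: only the cells of \<open>S\<close> are changed, and the zero content of fresh memory has
  to serve as the initial content of the tables. Weights are arbitrary rationals, so no value can
  mark a subset that cannot be covered by the colors treated so far. A separate array of natural
  numbers does this, and the same entry records the choice from which the coloring is recovered. The
  edge weights are read only once, at a cost proportional to \<open>card S\<close> times the degree;
  rows of sums indexed by colors replace the graph afterwards. The quadratic factor of the bound
  pays for rebuilding the class costs for each color, with every one of the at most
  \<open>card S\<close> squared doublings charged for a full table.\<close>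

definition runs :: "com \<Rightarrow> state \<Rightarrow> nat \<Rightarrow> (state \<Rightarrow> bool) \<Rightarrow> bool" where
  "runs P s T Q \<longleftrightarrow> (\<exists>t s'. exec P s t s' \<and> t \<le> T \<and> Q s')"

fun nmods :: "com \<Rightarrow> vname set" where
  "nmods Skip = {}"
| "nmods (NWrite x e f) = {x}"
| "nmods (RWrite x e f) = {}"
| "nmods (Seq P Q) = nmods P \<union> nmods Q"
| "nmods (If b P Q) = nmods P \<union> nmods Q"
| "nmods (While b P) = nmods P"

fun rmods :: "com \<Rightarrow> vname set" where
  "rmods Skip = {}"
| "rmods (NWrite x e f) = {}"
| "rmods (RWrite x e f) = {x}"
| "rmods (Seq P Q) = rmods P \<union> rmods Q"
| "rmods (If b P Q) = rmods P \<union> rmods Q"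
| "rmods (While b P) = rmods P"

text \<open>The frame condition, read off the syntax: arrays that occur on no left-hand side keep
  their contents. The rules supply it automatically, so assertions and invariants only have to speak
  about arrays that change.\<close>

definition agree :: "com \<Rightarrow> state \<Rightarrow> state \<Rightarrow> bool" where
  "agree P s s' \<longleftrightarrow> (\<forall>x. x \<notin> nmods P \<longrightarrow> nmem s' x = nmem s x) \<and>
     (\<forall>x. x \<notin> rmods P \<longrightarrow> rmem s' x = rmem s x)"

lemma nmem_nwrite [simp]: "nmem (nwrite x i n s) = (nmem s)(x := (nmem s x)(i := n))"
  and rmem_nwrite [simp]: "rmem (nwrite x i n s) = rmem s"
  and nmem_rwrite [simp]: "nmem (rwrite x i q s) = nmem s"
  and rmem_rwrite [simp]: "rmem (rwrite x i q s) = (rmem s)(x := (rmem s x)(i := q))"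
  by (simp_all add: nwrite_def rwrite_def)

lemma agreeD:
  assumes "agree P s s'"
  shows "x \<notin> nmods P \<Longrightarrow> nmem s' x = nmem s x" "x \<notin> rmods P \<Longrightarrow> rmem s' x = rmem s x"
  using assms by (simp_all add: agree_def)

lemma exec_agree: "exec P s t s' \<Longrightarrow> agree P s s'"
  by (induction rule: exec.induct) (auto simp: agree_def)

lemma agree_trans: "agree P s s' \<Longrightarrow> agree P s' s'' \<Longrightarrow> agree P s s''"
  by (simp add: agree_def)

text \<open>Time enters \<open>runs\<close> as an upper bound, which is what makes weakening
  possible. As \<open>exec\<close> is deterministic, the existential in \<open>runs\<close>
  describes the only halting run there is.\<close>

lemma runs_mono: "runs P s T Q \<Longrightarrow> T \<le> T' \<Longrightarrow> (\<And>s'. agree P s s' \<Longrightarrow> Q s' \<Longrightarrow> Q' s') \<Longrightarrow> runs P s T' Q'"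
  unfolding runs_def using exec_agree order_trans by meson

lemma runs_Skip [simp]: "runs Skip s T Q \<longleftrightarrow> 1 \<le> T \<and> Q s"
  unfolding runs_def by (blast elim: exec.cases intro: exec.Skip)

lemma runs_NWrite [simp]:
  "runs (NWrite x e f) s T Q \<longleftrightarrow> 1 \<le> T \<and> Q (nwrite x (nval e s) (nval f s) s)"
  unfolding runs_def by (metis exec.NWrite exec_deterministic)

lemma runs_RWrite [simp]:
  "runs (RWrite x e f) s T Q \<longleftrightarrow> 1 \<le> T \<and> Q (rwrite x (nval e s) (rval f s) s)"
  unfolding runs_def by (metis exec.RWrite exec_deterministic)

lemma runs_If [simp]:
  "runs (If b P Q) s T R \<longleftrightarrow>
    1 \<le> T \<and> (if bval b s then runs P s (T - 1) R else runs Q s (T - 1) R)"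
proof -
  have "exec (If b P Q) s t s' \<longleftrightarrow>
      (\<exists>u. t = 1 + u \<and> (if bval b s then exec P s u s' else exec Q s u s'))" for t s'
    by (cases "bval b s")
      (auto elim: exec.cases intro: exec.IfTrue[simplified] exec.IfFalse[simplified])
  then show ?thesis
    unfolding runs_def by (cases T; cases "bval b s") auto
qed

lemma runs_Seq:
  assumes "runs P s T R" "\<And>s'. agree P s s' \<Longrightarrow> R s' \<Longrightarrow> runs Q s' T' Q'"
    and "T + T' \<le> U"
  shows "runs (Seq P Q) s U Q'"
proof -
  obtain t s' where *: "exec P s t s'" "t \<le> T" "R s'"
    using assms(1) unfolding runs_def by blast
  then obtain t' s'' where "exec Q s' t' s''" "t' \<le> T'" "Q' s''"
    using assms(2) exec_agree unfolding runs_def by blast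
  with * show ?thesis
    unfolding runs_def using assms(3) by (meson add_mono exec.Seq order_trans)
qed

text \<open>An assignment at the head of a sequence is rewritten away, so that simplification
  executes straight-line code symbolically. The rule \<open>runs_Seq\<close> with its intermediate
  assertion is left for heads that contain loops.\<close>

lemma runs_Seq_NWrite [simp]:
  "runs (Seq (NWrite x e f) P) s T Q \<longleftrightarrow>
    1 \<le> T \<and> runs P (nwrite x (nval e s) (nval f s) s) (T - 1) Q"
proof -
  have "exec (Seq (NWrite x e f) P) s t s' \<longleftrightarrow>
      (\<exists>u. t = 1 + u \<and> exec P (nwrite x (nval e s) (nval f s) s) u s')" for t s'
    by (auto elim!: exec.cases[of "Seq _ _"] elim: exec.cases[of "NWrite _ _ _"]
        intro: exec.Seq[OF exec.NWrite, simplified])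
  then show ?thesis
    unfolding runs_def by (cases T) auto
qed

lemma runs_Seq_RWrite [simp]:
  "runs (Seq (RWrite x e f) P) s T Q \<longleftrightarrow>
    1 \<le> T \<and> runs P (rwrite x (nval e s) (rval f s) s) (T - 1) Q"
proof -
  have "exec (Seq (RWrite x e f) P) s t s' \<longleftrightarrow>
      (\<exists>u. t = 1 + u \<and> exec P (rwrite x (nval e s) (rval f s) s) u s')" for t s'
    by (auto elim!: exec.cases[of "Seq _ _"] elim: exec.cases[of "RWrite _ _ _"]
        intro: exec.Seq[OF exec.RWrite, simplified])
  then show ?thesis
    unfolding runs_def by (cases T) auto
qed

abbreviation seq (infixr \<open>;;\<close> 60) where "P ;; Q \<equiv> Seq P Q"

abbreviation var :: "vname \<Rightarrow> nexp" where "var x \<equiv> NRead x (NConst 0)"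

abbreviation assign :: "vname \<Rightarrow> nexp \<Rightarrow> com" where "assign x e \<equiv> NWrite x (NConst 0) e"

definition For :: "vname \<Rightarrow> nexp \<Rightarrow> com \<Rightarrow> com" where
  "For x e P = assign x (NConst 0) ;;
     While (NLess (var x) e) (P ;; assign x (NPlus (var x) (NConst 1)))"

lemma mods_For [simp]:
  "nmods (For x e P) = insert x (nmods P)" "rmods (For x e P) = rmods P"
  by (auto simp: For_def)

text \<open>One round costs its body, the test and the increment, hence \<open>B + 2\<close>; the
  last \<open>2\<close> pays for the initial assignment and the failing test. The bound
  \<open>e\<close> is evaluated again at every test, so it must have the same value in all states
  allowed by the frame condition.\<close>

lemma runs_For:
  assumes x: "x \<notin> nmods P"
    and bound: "\<And>s'. agree (For x e P) s s' \<Longrightarrow> nval e s' = n"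
    and init: "I 0 (nwrite x 0 0 s)"
    and step: "\<And>j s'. j < n \<Longrightarrow> agree (For x e P) s s' \<Longrightarrow> nmem s' x 0 = j \<Longrightarrow> I j s' \<Longrightarrow>
      runs P s' B (\<lambda>s''. I (Suc j) (nwrite x 0 (Suc j) s''))"
    and T: "n * (B + 2) + 2 \<le> T"
    and post: "\<And>s'. agree (For x e P) s s' \<Longrightarrow> I n s' \<Longrightarrow> Q s'"
  shows "runs (For x e P) s T Q"
proof -
  let ?B = "P ;; assign x (NPlus (var x) (NConst 1))"
  let ?W = "While (NLess (var x) e) ?B"
  have loop: "runs ?W s' (d * (B + 2) + 1) Q"
    if "j + d = n" "agree (For x e P) s s'" "nmem s' x 0 = j" "I j s'" for d j s'
    using that
  proof (induction d arbitrary: j s')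
    case 0
    then have "\<not> bval (NLess (var x) e) s'"
      using bound by simp
    then have "exec ?W s' 1 s'"
      by (rule exec.WhileFalse)
    then show ?case
      unfolding runs_def using post 0 by force
  next
    case (Suc d)
    have true: "bval (NLess (var x) e) s'"
      using Suc.prems bound by simp
    obtain t r where P: "exec P s' t r" "t \<le> B" "I (Suc j) (nwrite x 0 (Suc j) r)"
      using step[of j s'] Suc.prems unfolding runs_def by auto
    define r' where "r' = nwrite x 0 (Suc j) r"
    have "nmem r x 0 = j"
      using exec_agree[OF P(1)] x Suc.prems by (simp add: agree_def)
    then have body: "exec ?B s' (t + 1) r'"
      using exec.Seq[OF P(1) exec.NWrite[of x "NConst 0" "NPlus (var x) (NConst 1)"]]
      by (simp add: r'_def)
    have "agree (For x e P) s' r'"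
      using exec_agree[OF body] by (simp add: agree_def)
    then have "runs ?W r' (d * (B + 2) + 1) Q"
      using Suc.IH[of "Suc j" r'] Suc.prems agree_trans P(3) by (auto simp: r'_def)
    then obtain u q where u: "exec ?W r' u q" "u \<le> d * (B + 2) + 1" "Q q"
      unfolding runs_def by blast
    have "exec ?W s' (1 + (t + 1) + u) q"
      using true body u(1) by (rule exec.WhileTrue)
    moreover have "1 + (t + 1) + u \<le> Suc d * (B + 2) + 1"
      using u(2) P(2) by simp
    ultimately show ?case
      unfolding runs_def using u(3) by blast
  qed
  have "agree (For x e P) s (nwrite x 0 0 s)"
    by (simp add: agree_def)
  then have "runs ?W (nwrite x 0 0 s) (n * (B + 2) + 1) Q"
    using loop[of 0 n] init by simp
  then have "runs ?W (nwrite x 0 0 s) (T - 1) Q"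
    by (rule runs_mono) (use T in auto)
  then show ?thesis
    unfolding For_def using T by simp
qed

section \<open>Weights to the color classes and to the vertices of \<open>S\<close>\<close>

text \<open>The width of a row of \<open>W\<close>: the keys are the colors up to \<open>c\<close>
  and the private colors \<open>c + 1\<close> to \<open>c + size\<close>, so each key is an offset
  below this width.\<close>

abbreviation cells where "cells \<equiv> NPlus (var ''c'') (NPlus (var ''size'') (NConst 1))"

text \<open>
  The \<open>j\<close>-th vertex of \<open>S\<close> temporarily gets the private color \<open>c + 1 + j\<close>. Then a single look-up of
  the color of a neighbour tells to which entry of a row of \<open>W\<close> the edge weight is added: there is one
  entry for each color outside \<open>S\<close> and one for each vertex of \<open>S\<close>. \<open>RB j\<close> is the address of row \<open>j\<close>.
\<close>

definition prepare :: com where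
  "prepare = NWrite ''PW'' (NConst 0) (NConst 1) ;;
    For ''j'' (var ''size'')
     (NWrite ''col'' (NRead ''S'' (var ''j'')) (NPlus (var ''c'') (NPlus (NConst 1) (var ''j''))) ;;
      NWrite ''RB'' (NPlus (var ''j'') (NConst 1)) (NPlus (NRead ''RB'' (var ''j'')) cells) ;;
      NWrite ''PW'' (NPlus (var ''j'') (NConst 1))
        (NPlus (NRead ''PW'' (var ''j'')) (NRead ''PW'' (var ''j''))))"

text \<open>Row addresses and powers of two arise from the preceding entry by addition, which
  replaces the missing multiplication.\<close>

lemma runs_prepare:
  assumes s: "nmem s ''size'' 0 = m" "nmem s ''c'' 0 = c" "nmem s ''RB'' 0 = 0"
    and inj: "inj_on (nmem s ''S'') {..<m}"
  shows "runs prepare s (m * 5 + 3) (\<lambda>s'.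
    (\<forall>j\<le>m. nmem s' ''RB'' j = j * (c + m + 1)) \<and> (\<forall>j\<le>m. nmem s' ''PW'' j = 2 ^ j) \<and>
    (\<forall>j<m. nmem s' ''col'' (nmem s ''S'' j) = c + 1 + j) \<and>
    (\<forall>u. u \<notin> nmem s ''S'' ` {..<m} \<longrightarrow> nmem s' ''col'' u = nmem s ''col'' u))"
proof -
  define I where "I n s' \<longleftrightarrow> 
    (\<forall>j\<le>n. nmem s' ''RB'' j = j * (c + m + 1)) \<and> (\<forall>j\<le>n. nmem s' ''PW'' j = 2 ^ j) \<and>
    (\<forall>j<n. nmem s' ''col'' (nmem s ''S'' j) = c + 1 + j) \<and>
    (\<forall>u. u \<notin> nmem s ''S'' ` {..<m} \<longrightarrow> nmem s' ''col'' u = nmem s ''col'' u)" for n and s' :: state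
  show ?thesis
    unfolding prepare_def
    apply simp
    apply (rule runs_For[where n = m and I = I and B = 3])
    subgoal by simp
    subgoal by (simp add: agreeD s)
    subgoal by (simp add: I_def s)
    subgoal premises p for j s'
    proof -
      note [simp] = agreeD[OF p(2), simplified] p(3) s
      \<comment> \<open>The vertices listed in \<open>S\<close> are distinct, so writing the private
        color of index \<open>j\<close> does not overwrite an earlier one.\<close>
      have "nmem s ''S'' i \<noteq> nmem s ''S'' j" if "i < j" for i
        using inj_onD[OF inj, of i j] p(1) that by auto
      then show ?thesis
        using p(1,4) by (simp add: I_def le_Suc_eq less_Suc_eq all_conj_distrib)
    qed
    subgoal by simp
    subgoal by (simp add: I_def)
    done
qed


text \<open>Uniqueness of quotient and remainder; it guarantees that different rows of
  \<open>W\<close> share no cell.\<close>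

lemma row_eq_iff:
  fixes K :: nat
  assumes "q < K" "q' < K"
  shows "i * K + q = j * K + q' \<longleftrightarrow> i = j \<and> q = q'"
proof
  assume eq: "i * K + q = j * K + q'"
  then have "(i * K + q) div K = (j * K + q') div K" by simp
  then have "i = j" using assms by simp
  then show "i = j \<and> q = q'" using eq by simp
qed simp

abbreviation vertex :: nexp where "vertex \<equiv> NRead ''S'' (var ''j'')"
abbreviation slot :: nexp where "slot \<equiv> NPlus (NRead ''start'' vertex) (var ''p'')"
abbreviation weight_cell :: nexp where
  "weight_cell \<equiv> NPlus (NRead ''RB'' (var ''j'')) (NRead ''col'' (NRead ''adj'' slot))"

definition collect_weights :: com where
  "collect_weights = For ''j'' (var ''size'') (For ''p'' (NRead ''deg'' vertex)
     (RWrite ''W'' weight_cell (RPlus (RRead ''W'' weight_cell) (RRead ''wt'' slot))))"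

text \<open>Summation in place is correct because \<open>W\<close> starts as zero and each addition
  affects a single cell. No other stage has a running time depending on the degree, so the degree
  term of the final bound comes from here.\<close>

lemma runs_collect_weights:
  fixes s :: state
  defines "sv \<equiv> nmem s ''S''"
  defines "dg \<equiv> \<lambda>j. nmem s ''deg'' (sv j)"
  defines "key \<equiv> \<lambda>j p. nmem s ''col'' (nmem s ''adj'' (nmem s ''start'' (sv j) + p))"
  defines "val \<equiv> \<lambda>j p. rmem s ''wt'' (nmem s ''start'' (sv j) + p)"
  assumes s: "nmem s ''size'' 0 = m" "rmem s ''W'' = (\<lambda>_. 0)"
    and RB: "\<And>j. j < m \<Longrightarrow> nmem s ''RB'' j = j * K"
    and dg: "\<And>j. j < m \<Longrightarrow> dg j \<le> D"
    and key: "\<And>j p. j < m \<Longrightarrow> p < dg j \<Longrightarrow> key j p < K"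
  shows "runs collect_weights s (m * (D * 3 + 4) + 2) (\<lambda>s'.
    \<forall>j<m. \<forall>q<K. rmem s' ''W'' (j * K + q) = (\<Sum>p | p < dg j \<and> key j p = q. val j p))"
proof -
  define part where "part j n q = (\<Sum>p | p < n \<and> key j p = q. val j p)" for j n q
  have part_0: "part j 0 q = 0" for j q
    by (simp add: part_def)
  have part_Suc: "part j (Suc n) q = part j n q + (if key j n = q then val j n else 0)" for j n q
  proof -
    have "{p. p < Suc n \<and> key j p = q} =
        (if key j n = q then insert n {p. p < n \<and> key j p = q} else {p. p < n \<and> key j p = q})"
      by (auto simp: less_Suc_eq)
    then show ?thesis
      by (simp add: part_def add.commute)
  qed
  define I where "I n s' \<longleftrightarrow> (\<forall>j<m. \<forall>q<K. rmem s' ''W'' (j * K + q) =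
      (if j < n then part j (dg j) q else 0))" for n and s' :: state
  show ?thesis
    unfolding collect_weights_def
    apply (rule runs_For[where n = m and I = I and B = "D * 3 + 2"])
    subgoal by simp
    subgoal by (simp add: agreeD s)
    subgoal by (simp add: I_def s)
    subgoal premises p for j s'
    proof -
      note [simp] = agreeD[OF p(2), simplified] p(3) s
      \<comment> \<open>Rows before \<open>j\<close> are complete, row \<open>j\<close> holds the
        sums over the first \<open>n\<close> list positions, later rows are still zero.\<close>
      define J where "J n r \<longleftrightarrow> (\<forall>i<m. \<forall>q<K. rmem r ''W'' (i * K + q) =
        (if i < j then part i (dg i) q else if i = j then part j n q else 0))" for n and r :: state
      show ?thesis
        apply (rule runs_For[where n = "dg j" and I = J and B = 1])
        subgoal by simp
        subgoal by (simp add: agreeD sv_def dg_def)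
        subgoal using p(4) by (auto simp: J_def I_def part_0)
        subgoal premises r for n s''
        proof -
          note [simp] = agreeD[OF r(2), simplified] r(3)
          have "nmem s ''col'' (nmem s ''adj'' (nmem s ''start'' (nmem s ''S'' j) + n)) = key j n"
            "rmem s ''wt'' (nmem s ''start'' (nmem s ''S'' j) + n) = val j n"
            by (simp_all add: key_def val_def sv_def)
          then show ?thesis
            using r(4) key[OF p(1) r(1)] p(1) RB
            by (auto simp: J_def part_Suc row_eq_iff)
        qed
        subgoal using dg[OF p(1)] by simp
        subgoal by (auto simp: J_def I_def less_Suc_eq)
        done
    qed
    subgoal by (simp add: algebra_simps)
    subgoal by (simp add: I_def part_def)
    done
qed

section \<open>Binary codes of index sets and the enumeration of disjoint pairs\<close>

lemma set_encode_less: "A \<subseteq> {..<m} \<Longrightarrow> set_encode A < 2 ^ m"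
proof (induction m arbitrary: A)
  case (Suc m)
  have "finite A" using Suc.prems finite_subset by blast
  have "set_encode (A - {m}) < 2 ^ m"
    by (rule Suc.IH) (use Suc.prems in force)
  moreover have "set_encode A \<le> set_encode (A - {m}) + 2 ^ m"
    using \<open>finite A\<close> by (cases "m \<in> A") (auto simp: set_encode_def sum.remove)
  ultimately show ?case by simp
qed simp

text \<open>Adjoining the next index translates codes by a power of two. A table over the subsets of
  \<open>{..<m}\<close> thus occupies the addresses below \<open>2 ^ m\<close>, and its extension is
  a modified copy in the block right above.\<close>

lemma set_encode_insert_top:
  "A \<subseteq> {..<m} \<Longrightarrow> set_encode (insert m A) = 2 ^ m + set_encode A"
  by (subst set_encode_insert) (auto dest: finite_subset)

text \<open>No carries occur for disjoint sets, so one addition yields the address of a union and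
  one subtraction removes a part.\<close>

lemma set_encode_Un:
  "finite A \<Longrightarrow> finite B \<Longrightarrow> A \<inter> B = {} \<Longrightarrow> set_encode (A \<union> B) = set_encode A + set_encode B"
  by (simp add: set_encode_def sum.union_disjoint)

lemma set_encode_full: "set_encode {..<m} = 2 ^ m - 1"
proof -
  have "set_encode {..<m} + 1 = 2 ^ m"
    by (induction m) (simp_all add: lessThan_Suc set_encode_insert)
  then show ?thesis by simp
qed

lemma subset_lessThan_Suc_cases:
  assumes "A \<subseteq> {..<Suc m}"
  obtains "A \<subseteq> {..<m}" | B where "B \<subseteq> {..<m}" "A = insert m B"
proof (cases "m \<in> A")
  case True
  then have "A - {m} \<subseteq> {..<m}" "A = insert m (A - {m})"
    using assms by (auto simp: less_Suc_eq)
  then show ?thesis using that by blast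
next
  case False
  then have "A \<subseteq> {..<m}"
    using assms by (auto simp: subset_iff less_Suc_eq)
  then show ?thesis using that by blast
qed

text \<open>A set rather than a list: the minimization reads one level and writes another, so the
  order in which the pairs are visited is irrelevant.\<close>

definition disjoint_codes :: "nat \<Rightarrow> (nat \<times> nat) set" where
  "disjoint_codes m =
    {(set_encode A, set_encode B) | A B. A \<subseteq> {..<m} \<and> B \<subseteq> {..<m} \<and> A \<inter> B = {}}"

lemma disjoint_codes_0: "disjoint_codes 0 = {(0, 0)}"
  by (auto simp: disjoint_codes_def)

text \<open>The new index belongs to neither set, to the first or to the second; these three copies
  are the source of the base \<open>3\<close>.\<close>

lemma disjoint_codes_Suc:
  "disjoint_codes (Suc m) = disjoint_codes m \<union> (\<lambda>(a, b). (a + 2 ^ m, b)) ` disjoint_codes m \<union>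
     (\<lambda>(a, b). (a, b + 2 ^ m)) ` disjoint_codes m" (is "?L = ?R")
proof (rule set_eqI)
  fix z
  have enc: "set_encode (insert m A) = set_encode A + 2 ^ m" if "A \<subseteq> {..<m}" for A
    using set_encode_insert_top[OF that] by simp
  show "z \<in> ?L \<longleftrightarrow> z \<in> ?R"
  proof
    assume "z \<in> ?L"
    then obtain A B where AB: "z = (set_encode A, set_encode B)" "A \<subseteq> {..<Suc m}" "B \<subseteq> {..<Suc m}"
      "A \<inter> B = {}"
      by (auto simp: disjoint_codes_def)
    from AB(2,3) show "z \<in> ?R"
      apply (elim subset_lessThan_Suc_cases)
      subgoal using AB by (auto simp: disjoint_codes_def)
      subgoal for B' using AB enc by (auto simp: disjoint_codes_def image_iff)
      subgoal for A' using AB enc by (auto simp: disjoint_codes_def image_iff)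
      \<comment> \<open>Here \<open>m\<close> would lie in both sets, against disjointness.\<close>
      subgoal using AB by auto
      done
  next
    have in_L: "(set_encode A, set_encode B) \<in> ?L"
      if "A \<subseteq> {..<Suc m}" "B \<subseteq> {..<Suc m}" "A \<inter> B = {}" for A B
      using that by (auto simp: disjoint_codes_def)
    assume "z \<in> ?R"
    then consider A B where "z = (set_encode A, set_encode B)" "A \<subseteq> {..<m}" "B \<subseteq> {..<m}" "A \<inter> B = {}"
      | A B where "z = (set_encode A + 2 ^ m, set_encode B)" "A \<subseteq> {..<m}" "B \<subseteq> {..<m}" "A \<inter> B = {}"
      | A B where "z = (set_encode A, set_encode B + 2 ^ m)" "A \<subseteq> {..<m}" "B \<subseteq> {..<m}" "A \<inter> B = {}"
      unfolding disjoint_codes_def by (elim UnE imageE CollectE exE conjE) (auto split: prod.splits)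
    then show "z \<in> ?L"
    proof cases
      case 1
      then show ?thesis using in_L[of A B] by (simp add: subset_iff less_Suc_eq)
    next
      case 2
      then show ?thesis using in_L[of "insert m A" B] enc by (auto simp: subset_iff less_Suc_eq)
    next
      case 3
      then show ?thesis using in_L[of A "insert m B"] enc by (auto simp: subset_iff less_Suc_eq)
    qed
  qed
qed

text \<open>The initial list of length one, the pair of empty sets, is the zero content of memory.
  Each round leaves the first \<open>L\<close> entries in place, puts the copies with the new index
  in the first set behind them, and then those with it in the second. \<open>L\<close> bounds the
  inner loop and is therefore changed only after it.\<close>

definition list_pairs :: com where
  "list_pairs = assign ''L'' (NConst 1) ;;
    For ''j'' (var ''size'')
     (For ''l'' (var ''L'')
       (NWrite ''PZ'' (NPlus (var ''L'') (var ''l''))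
          (NPlus (NRead ''PZ'' (var ''l'')) (NRead ''PW'' (var ''j''))) ;;
        NWrite ''PY'' (NPlus (var ''L'') (var ''l'')) (NRead ''PY'' (var ''l'')) ;;
        NWrite ''PZ'' (NPlus (var ''L'') (NPlus (var ''L'') (var ''l''))) (NRead ''PZ'' (var ''l'')) ;;
        NWrite ''PY'' (NPlus (var ''L'') (NPlus (var ''L'') (var ''l'')))
          (NPlus (NRead ''PY'' (var ''l'')) (NRead ''PW'' (var ''j'')))) ;;
      assign ''L'' (NPlus (var ''L'') (NPlus (var ''L'') (var ''L''))))"

lemma lessThan_triple: "{..<3 * (n::nat)} = {..<n} \<union> (+) n ` {..<n} \<union> (+) (n + n) ` {..<n}"
proof -
  have "x \<in> (+) n ` {..<n} \<longleftrightarrow> n \<le> x \<and> x < n + n" for x n :: nat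
    by (auto simp: image_iff intro!: bexI[of _ "x - n"])
  moreover have "x \<in> (+) (n + n) ` {..<n} \<longleftrightarrow> n + n \<le> x \<and> x < 3 * n" for x
    by (auto simp: image_iff intro!: bexI[of _ "x - (n + n)"])
  ultimately show ?thesis by auto
qed

text \<open>Every round is charged for the final length \<open>3 ^ m\<close>. A geometric sum would
  save the factor \<open>m\<close>, but the final bound has room for it.\<close>

lemma runs_list_pairs:
  assumes s: "nmem s ''size'' 0 = m" "nmem s ''PZ'' = (\<lambda>_. 0)" "nmem s ''PY'' = (\<lambda>_. 0)"
    and PW: "\<And>j. j < m \<Longrightarrow> nmem s ''PW'' j = 2 ^ j"
  shows "runs list_pairs s (m * (3 ^ m * 6 + 5) + 3) (\<lambda>s'. nmem s' ''L'' 0 = 3 ^ m \<and>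
    (\<lambda>l. (nmem s' ''PZ'' l, nmem s' ''PY'' l)) ` {..<3 ^ m} = disjoint_codes m)"
proof -
  define I where "I n s' \<longleftrightarrow> nmem s' ''L'' 0 = 3 ^ n \<and>
    (\<lambda>l. (nmem s' ''PZ'' l, nmem s' ''PY'' l)) ` {..<3 ^ n} = disjoint_codes n" for n and s' :: state
  show ?thesis
    unfolding list_pairs_def
    apply simp
    apply (rule runs_For[where n = m and I = I and B = "3 ^ m * 6 + 3"])
    subgoal by simp
    subgoal by (simp add: agreeD s)
    subgoal by (simp add: I_def s disjoint_codes_0 lessThan_Suc)
    subgoal premises p for j s'
    proof -
      note [simp] = agreeD[OF p(2), simplified] p(3) s
      define L where "L = nmem s' ''L'' 0"
      have L: "L = 3 ^ j" using p(4) by (simp add: L_def I_def)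
      define Z Y where "Z = nmem s' ''PZ''" and "Y = nmem s' ''PY''"
      define J where "J n r \<longleftrightarrow> (\<forall>l<L. nmem r ''PZ'' l = Z l \<and> nmem r ''PY'' l = Y l) \<and>
        (\<forall>l<n. nmem r ''PZ'' (L + l) = Z l + 2 ^ j \<and> nmem r ''PY'' (L + l) = Y l \<and>
          nmem r ''PZ'' (L + (L + l)) = Z l \<and> nmem r ''PY'' (L + (L + l)) = Y l + 2 ^ j)" for n and r :: state
      show ?thesis
        apply (rule runs_Seq[where R = "J L" and T = "3 ^ m * 6 + 2" and T' = 1])
         apply (rule runs_For[where n = L and I = J and B = 4])
        subgoal by simp
        subgoal by (simp add: agreeD L_def)
        subgoal by (simp add: J_def Z_def Y_def)
        subgoal premises r for n s''
        proof -
          note [simp] = agreeD[OF r(2), simplified] r(3)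
          show ?thesis
            using r(1,4) p(1) PW
            by (simp add: J_def L_def[symmetric] less_Suc_eq all_conj_distrib)
        qed
        subgoal
          using power_increasing[of j m "3::nat"] p(1) by (simp add: L)
        subgoal by simp
        subgoal premises r for s''
        proof -
          note [simp] = agreeD[OF r(1), simplified]
          have "(\<lambda>l. (nmem s'' ''PZ'' l, nmem s'' ''PY'' l)) ` {..<3 ^ Suc j} = disjoint_codes (Suc j)"
          proof -
            let ?f = "\<lambda>l. (nmem s'' ''PZ'' l, nmem s'' ''PY'' l)"
            have D: "disjoint_codes j = (\<lambda>l. (Z l, Y l)) ` {..<L}"
              using p(4) by (simp add: I_def L Z_def Y_def)
            have "?f ` {..<3 ^ Suc j} = ?f ` {..<L} \<union> (\<lambda>l. ?f (L + l)) ` {..<L} \<union> (\<lambda>l. ?f (L + L + l)) ` {..<L}"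
              by (simp only: power_Suc L[symmetric] lessThan_triple image_Un image_image)
            also have "\<dots> = disjoint_codes (Suc j)"
              unfolding disjoint_codes_Suc D image_image
              using r(2) by (auto simp: J_def add.assoc image_iff)
            finally show ?thesis .
          qed
          then show ?thesis
            by (simp add: I_def L_def[symmetric] L)
        qed
        subgoal by simp
        done
    qed
    subgoal by simp
    subgoal by (simp add: I_def)
    done
qed

section \<open>Dynamic programming over the colors\<close>

text \<open>
  The monochromatic weight caused by giving color \<open>i\<close> to the vertices of \<open>S\<close> with indices in \<open>A\<close>.
\<close>

definition class_cost :: "(nat \<Rightarrow> nat \<Rightarrow> rat) \<Rightarrow> nat \<Rightarrow> nat \<Rightarrow> nat set \<Rightarrow> rat" where
  "class_cost w c i A = (\<Sum>j\<in>A. w j i + (\<Sum>l\<in>A \<inter> {..<j}. w j (c + 1 + l)))"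

lemma class_cost_empty [simp]: "class_cost w c i {} = 0"
  by (simp add: class_cost_def)

text \<open>The largest index pays for all its edges into the class and leaves the earlier charges
  as they were; this is the recursion by which the cost table is doubled.\<close>

lemma class_cost_insert_top:
  assumes "A \<subseteq> {..<m}"
  shows "class_cost w c i (insert m A) = class_cost w c i A + (w m i + (\<Sum>l\<in>A. w m (c + 1 + l)))"
proof -
  have "finite A" "m \<notin> A" using assms finite_subset by auto
  moreover have "insert m A \<inter> {..<j} = A \<inter> {..<j}" if "j \<in> A" for j
    using assms that by auto
  moreover have "insert m A \<inter> {..<m} = A" using assms by auto
  ultimately show ?thesis
    by (simp add: class_cost_def)
qed

text \<open>For vertex \<open>j\<close>, the array \<open>N\<close> sends the code of a set of
  smaller indices to the charge of \<open>j\<close> when that set is the rest of its class. It is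
  itself doubled once for each \<open>l\<close> below \<open>j\<close>, after which one doubling
  extends \<open>G\<close>. The counter \<open>i\<close> starts at zero and stands for the color
  \<open>i + 1\<close>.\<close>

definition compute_costs :: com where
  "compute_costs = For ''j'' (var ''size'')
    (RWrite ''N'' (NConst 0) (RRead ''W'' (NPlus (NRead ''RB'' (var ''j'')) (NPlus (var ''i'') (NConst 1)))) ;;
     For ''l'' (var ''j'') (For ''y'' (NRead ''PW'' (var ''l''))
       (RWrite ''N'' (NPlus (NRead ''PW'' (var ''l'')) (var ''y''))
         (RPlus (RRead ''N'' (var ''y''))
           (RRead ''W'' (NPlus (NRead ''RB'' (var ''j'')) (NPlus (NPlus (var ''c'') (NConst 1)) (var ''l''))))))) ;;
     For ''y'' (NRead ''PW'' (var ''j''))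
       (RWrite ''G'' (NPlus (NRead ''PW'' (var ''j'')) (var ''y''))
         (RPlus (RRead ''G'' (var ''y'')) (RRead ''N'' (var ''y'')))))"

text \<open>Of the old contents of \<open>G\<close> only the entry for the empty set matters: all
  others are rewritten before they are read, and likewise those of \<open>N\<close>. Hence both
  arrays are reused for every color without being cleared.\<close>

lemma runs_compute_costs:
  assumes s: "nmem s ''size'' 0 = m" "nmem s ''c'' 0 = c" "nmem s ''i'' 0 = i" "rmem s ''G'' 0 = 0"
    and "i < c"
    and PW: "\<And>j. j \<le> m \<Longrightarrow> nmem s ''PW'' j = 2 ^ j"
    and RB: "\<And>j. j < m \<Longrightarrow> nmem s ''RB'' j = j * (c + m + 1)"
    and W: "\<And>j q. j < m \<Longrightarrow> q < c + m + 1 \<Longrightarrow> rmem s ''W'' (j * (c + m + 1) + q) = w j q"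
  shows "runs compute_costs s (m * (m * (2 ^ m * 3 + 4) + 2 ^ m * 3 + 7) + 2)
    (\<lambda>s'. \<forall>A\<subseteq>{..<m}. rmem s' ''G'' (set_encode A) = class_cost w c (i + 1) A)"
proof -
  define I where "I n s' \<longleftrightarrow> (\<forall>A\<subseteq>{..<n}. rmem s' ''G'' (set_encode A) = class_cost w c (i + 1) A)"
    for n and s' :: state
  show ?thesis
    unfolding compute_costs_def
    apply (rule runs_For[where n = m and I = I and B = "m * (2 ^ m * 3 + 4) + 2 ^ m * 3 + 5"])
    subgoal by simp
    subgoal by (simp add: agreeD s)
    subgoal by (simp add: I_def s)
    subgoal premises p for j s0
    proof -
      note [simp] = agreeD[OF p(2), simplified] p(3) s
      have pow_le: "2 ^ l * (1 + 2) + 2 \<le> (2 ^ m * 3 + 2 :: nat)" if "l \<le> m" for l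
        by (intro add_mono mult_mono) (simp_all add: that)
      have Wji: "rmem s ''W'' (nmem s ''RB'' j + (i + 1)) = w j (i + 1)"
        using W[of j "i + 1"] RB[of j] p(1) \<open>i < c\<close> by simp
      define s' where "s' = rwrite ''N'' 0 (w j (i + 1)) s0"
      define nb where "nb A = w j (i + 1) + (\<Sum>l\<in>A. w j (c + 1 + l))" for A
      define H where "H n r \<longleftrightarrow> (\<forall>A\<subseteq>{..<n}. rmem r ''N'' (set_encode A) = nb A)"
        for n and r :: state
      have nmem_s': "nmem s' = nmem s0" and rmem_s': "x \<noteq> ''N'' \<Longrightarrow> rmem s' x = rmem s0 x" for x
        by (simp_all add: s'_def)
      note [simp] = nmem_s' rmem_s'
      \<comment> \<open>The array after \<open>n\<close> copies, relative to its contents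
        \<open>v\<close> before the loop. Copies are read below \<open>2 ^ l\<close> only, where the
        loop writes nothing.\<close>
      define J where "J l v n r \<longleftrightarrow> (\<forall>x. rmem r ''N'' x =
        (if 2 ^ l \<le> x \<and> x < 2 ^ l + n then v (x - 2 ^ l) + w j (c + 1 + l) else v x))"
        for l v n and r :: state
      define J' where "J' v n r \<longleftrightarrow> (\<forall>x. rmem r ''G'' x =
        (if 2 ^ j \<le> x \<and> x < 2 ^ j + n then rmem s0 ''G'' (x - 2 ^ j) + v (x - 2 ^ j) else rmem s0 ''G'' x))"
        for v n and r :: state
      show ?thesis
        apply (simp add: Wji[simplified] s'_def[symmetric, simplified])
        apply (rule runs_Seq[where R = "H j" and T = "m * (2 ^ m * 3 + 4) + 2"
              and T' = "2 ^ m * 3 + 2"])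
          apply (rule runs_For[where n = j and I = H and B = "2 ^ m * 3 + 2"])
        subgoal by simp
        subgoal by (simp add: agreeD)
        subgoal by (simp add: H_def nb_def s'_def)
        subgoal premises r for l r
        proof -
          note [simp] = agreeD[OF r(2), simplified] r(3)
          have l: "l < m" "l \<le> m" using r(1) p(1) by auto
          have Wjl: "rmem s ''W'' (nmem s ''RB'' j + (c + 1 + l)) = w j (c + 1 + l)"
            using W[of j "c + 1 + l"] RB[of j] p(1) l by simp
          show ?thesis
            apply (rule runs_For[where n = "2 ^ l" and I = "J l (rmem r ''N'')" and B = 1])
            subgoal by simp
            subgoal by (simp add: agreeD PW l)
            subgoal by (simp add: J_def)
            subgoal premises q for y r'
            proof -
              note [simp] = agreeD[OF q(2), simplified] q(3)
              show ?thesis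
                using q(1,4) Wjl by (auto simp: J_def PW l)
            qed
            subgoal by (rule pow_le[OF l(2)])
            subgoal premises q for r'
              unfolding H_def
            proof (intro allI impI)
              fix A assume "A \<subseteq> {..<Suc l}"
              then show "rmem (nwrite ''l'' 0 (Suc l) r') ''N'' (set_encode A) = nb A"
              proof (cases rule: subset_lessThan_Suc_cases)
                case 1
                then show ?thesis
                  using q(2) r(4) set_encode_less[OF 1] by (simp add: J_def H_def)
              next
                case (2 B)
                have B: "finite B" "l \<notin> B" using 2 finite_subset by auto
                show ?thesis
                  using q(2) r(4) set_encode_less[OF 2(1)] set_encode_insert_top[OF 2(1)] 2 B
                  by (simp add: J_def H_def nb_def)
              qed
            qed
            done
        qed
        subgoal using mult_le_mono1[of j m "2 ^ m * 3 + 4"] p(1) by (simp add: algebra_simps)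
        subgoal by simp
        subgoal premises r for r
        proof -
          note [simp] = agreeD[OF r(1), simplified]
          have j: "j \<le> m" using p(1) by simp
          show ?thesis
            apply (rule runs_For[where n = "2 ^ j" and I = "J' (rmem r ''N'')" and B = 1])
            subgoal by simp
            subgoal by (simp add: agreeD PW j)
            subgoal by (simp add: J'_def)
            subgoal premises q for y r'
            proof -
              note [simp] = agreeD[OF q(2), simplified] q(3)
              show ?thesis
                using q(1,4) by (auto simp: J'_def PW j)
            qed
            subgoal by (rule pow_le[OF j])
            subgoal premises q for r'
              unfolding I_def
            proof (intro allI impI)
              fix A assume "A \<subseteq> {..<Suc j}"
              then show "rmem (nwrite ''j'' 0 (Suc j) r') ''G'' (set_encode A) = class_cost w c (i + 1) A"
              proof (cases rule: subset_lessThan_Suc_cases)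
                case 1
                then show ?thesis
                  using q(2) p(4) set_encode_less[OF 1] by (simp add: J'_def I_def)
              next
                case (2 B)
                show ?thesis
                  using q(2) p(4) r(2) set_encode_less[OF 2(1)] set_encode_insert_top[OF 2(1)] 2
                  by (simp add: J'_def I_def H_def class_cost_insert_top nb_def)
              qed
            qed
            done
        qed
        subgoal by simp
        done
    qed
    subgoal by (simp add: algebra_simps)
    subgoal by (simp add: I_def)
    done
qed

text \<open>
  The tables of consecutive colors start at the addresses \<open>P\<close> and \<open>Q\<close>. An entry of \<open>D\<close> is \<open>0\<close> if
  no coloring of the subset has been found, and otherwise one more than the code of the color class
  chosen last.
\<close>

definition dp_level ::
  "nat \<Rightarrow> (nat set \<Rightarrow> rat) \<Rightarrow> nat \<Rightarrow> nat \<Rightarrow> (nat \<Rightarrow> nat) \<Rightarrow> (nat \<Rightarrow> rat) \<Rightarrow> bool" where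
  "dp_level m g P Q D T \<longleftrightarrow>
    (\<forall>A B. A \<subseteq> {..<m} \<longrightarrow> B \<subseteq> {..<m} \<longrightarrow> A \<inter> B = {} \<longrightarrow> 0 < D (P + set_encode A) \<longrightarrow>
      0 < D (Q + set_encode (A \<union> B)) \<and>
      T (Q + set_encode (A \<union> B)) \<le> T (P + set_encode A) + g B) \<and>
    (\<forall>X\<subseteq>{..<m}. 0 < D (Q + set_encode X) \<longrightarrow>
      (\<exists>A B. X = A \<union> B \<and> A \<inter> B = {} \<and> 0 < D (P + set_encode A) \<and>
        D (Q + set_encode X) = Suc (set_encode B) \<and>
        T (Q + set_encode X) = T (P + set_encode A) + g B))"

abbreviation source_cell :: nexp where
  "source_cell \<equiv> NPlus (var ''prev'') (NRead ''PZ'' (var ''l''))"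

abbreviation target_cell :: nexp where
  "target_cell \<equiv> NPlus (var ''cur'') (NPlus (NRead ''PZ'' (var ''l'')) (NRead ''PY'' (var ''l'')))"

abbreviation candidate :: rexp where
  "candidate \<equiv> RPlus (RRead ''T'' source_cell) (RRead ''G'' (NRead ''PY'' (var ''l'')))"

text \<open>The nested test says that the source is defined and that the target is undefined or
  strictly worse than the candidate.\<close>

definition relax :: com where
  "relax = For ''l'' (var ''L'')
    (If (BAnd (NLess (NConst 0) (NRead ''D'' source_cell))
          (BNot (BAnd (NLess (NConst 0) (NRead ''D'' target_cell))
            (BNot (RLess candidate (RRead ''T'' target_cell))))))
      (RWrite ''T'' target_cell candidate ;;
       NWrite ''D'' target_cell (NPlus (NRead ''PY'' (var ''l'')) (NConst 1)))
      Skip)"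

text \<open>Writes stay in the block of \<open>2 ^ m\<close> cells from \<open>Q\<close> on, above
  the source block, so all candidates keep their values throughout the loop. The two halves of
  \<open>dp_level\<close> come from two invariants: processed pairs bound their targets from above,
  and defined targets are attained by some pair.\<close>

lemma runs_relax:
  assumes s: "nmem s ''L'' 0 = L" "nmem s ''prev'' 0 = P" "nmem s ''cur'' 0 = Q"
    and PQ: "P + 2 ^ m \<le> Q"
    and pairs: "(\<lambda>l. (nmem s ''PZ'' l, nmem s ''PY'' l)) ` {..<L} = disjoint_codes m"
    and G: "\<And>A. A \<subseteq> {..<m} \<Longrightarrow> rmem s ''G'' (set_encode A) = g A"
    and D0: "\<And>x. x < 2 ^ m \<Longrightarrow> nmem s ''D'' (Q + x) = 0"
  shows "runs relax s (L * 5 + 2) (\<lambda>s'.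
    (\<forall>x. x < Q \<or> Q + 2 ^ m \<le> x \<longrightarrow> nmem s' ''D'' x = nmem s ''D'' x \<and> rmem s' ''T'' x = rmem s ''T'' x) \<and>
    dp_level m g P Q (nmem s' ''D'') (rmem s' ''T''))"
proof -
  define D T Z Y where "D = nmem s ''D''" and "T = rmem s ''T''"
    and "Z = nmem s ''PZ''" and "Y = nmem s ''PY''"
  define cand where "cand l = T (P + Z l) + rmem s ''G'' (Y l)" for l
  \<comment> \<open>The witness for attainment is bounded by \<open>L\<close> instead of
    \<open>n\<close>: any listed pair will do, so this half need not follow the progress of the
    loop.\<close>
  define I where "I n s' \<longleftrightarrow>
    (\<forall>x. x < Q \<or> Q + 2 ^ m \<le> x \<longrightarrow> nmem s' ''D'' x = D x \<and> rmem s' ''T'' x = T x) \<and>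
    (\<forall>l<n. 0 < D (P + Z l) \<longrightarrow> 0 < nmem s' ''D'' (Q + (Z l + Y l)) \<and>
      rmem s' ''T'' (Q + (Z l + Y l)) \<le> cand l) \<and>
    (\<forall>x<2 ^ m. 0 < nmem s' ''D'' (Q + x) \<longrightarrow>
      (\<exists>l<L. x = Z l + Y l \<and> 0 < D (P + Z l) \<and> nmem s' ''D'' (Q + x) = Suc (Y l) \<and>
        rmem s' ''T'' (Q + x) = cand l))" for n and s' :: state
  have I_out: "nmem r ''D'' x = D x" "rmem r ''T'' x = T x"
    if "I n r" "x < Q \<or> Q + 2 ^ m \<le> x" for n r x
    using that unfolding I_def by blast+
  have I_le: "0 < nmem r ''D'' (Q + (Z l + Y l)) \<and> rmem r ''T'' (Q + (Z l + Y l)) \<le> cand l"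
    if "I n r" "l < n" "0 < D (P + Z l)" for n r l
    using that unfolding I_def by blast
  have I_ex: "\<exists>l<L. x = Z l + Y l \<and> 0 < D (P + Z l) \<and> nmem r ''D'' (Q + x) = Suc (Y l) \<and>
      rmem r ''T'' (Q + x) = cand l" if "I n r" "x < 2 ^ m" "0 < nmem r ''D'' (Q + x)" for n r x
    using that unfolding I_def by blast
  have pair: "\<exists>A B. A \<subseteq> {..<m} \<and> B \<subseteq> {..<m} \<and> A \<inter> B = {} \<and> Z l = set_encode A \<and> Y l = set_encode B"
    if "l < L" for l
  proof -
    have "(Z l, Y l) \<in> disjoint_codes m"
      unfolding pairs[symmetric] Z_def Y_def using that by blast
    then show ?thesis
      unfolding disjoint_codes_def by blast
  qed
  have enc_Un: "set_encode (A \<union> B) = set_encode A + set_encode B"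
    if "A \<subseteq> {..<m}" "B \<subseteq> {..<m}" "A \<inter> B = {}" for A B
    using that by (intro set_encode_Un) (auto dest: finite_subset)
  have ZY: "Z l < 2 ^ m" "Z l + Y l < 2 ^ m" if l: "l < L" for l
  proof -
    obtain A B where AB: "A \<subseteq> {..<m}" "B \<subseteq> {..<m}" "A \<inter> B = {}" "Z l = set_encode A" "Y l = set_encode B"
      using pair[OF l] by blast
    then show "Z l < 2 ^ m" "Z l + Y l < 2 ^ m"
      using set_encode_less[of "A \<union> B" m] enc_Un[of A B] by auto
  qed
  show ?thesis
    unfolding relax_def
    apply (rule runs_For[where n = L and I = I and B = 3])
    subgoal by simp
    subgoal by (simp add: agreeD s)
    subgoal using D0 by (simp add: I_def D_def T_def)
    subgoal premises p for l s'
    proof -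
      note [simp] = agreeD[OF p(2), simplified] p(3) s
      note fold = Z_def[symmetric] Y_def[symmetric]
      have low: "P + Z l < Q"
        using ZY[OF p(1)] PQ by linarith
      then have src: "nmem s' ''D'' (P + Z l) = D (P + Z l)" "rmem s' ''T'' (P + Z l) = T (P + Z l)"
        using I_out[OF p(4)] by simp_all
      define q where "q = Q + (Z l + Y l)"
      let ?c = "0 < D (P + Z l) \<and> \<not> (0 < nmem s' ''D'' q \<and> \<not> cand l < rmem s' ''T'' q)"
      define u where "u = (if ?c then nwrite ''D'' q (Suc (Y l)) (rwrite ''T'' q (cand l) s') else s')"
      have "I (Suc l) u"
      proof (cases ?c)
        case True
        have qne: "q \<noteq> x" if "x < Q \<or> Q + 2 ^ m \<le> x" for x
          using that ZY[OF p(1)] by (auto simp: q_def)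
        have "0 < nmem u ''D'' (Q + (Z k + Y k)) \<and> rmem u ''T'' (Q + (Z k + Y k)) \<le> cand k"
          if k: "k < Suc l" "0 < D (P + Z k)" for k
        proof (cases "k = l")
          case False
          then have "0 < nmem s' ''D'' (Q + (Z k + Y k)) \<and> rmem s' ''T'' (Q + (Z k + Y k)) \<le> cand k"
            using I_le[OF p(4)] k by simp
          \<comment> \<open>A defined target is replaced only by a strictly smaller candidate, so
            the bounds for earlier pairs persist.\<close>
          moreover have "rmem u ''T'' x \<le> rmem s' ''T'' x" if "0 < nmem s' ''D'' x" for x
            using True that by (auto simp: u_def)
          moreover have "0 < nmem u ''D'' x" if "0 < nmem s' ''D'' x" for x
            using True that by (simp add: u_def)
          ultimately show ?thesis
            by (meson order_trans)
        qed (use True in \<open>simp add: u_def q_def\<close>)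
        moreover have "\<exists>k<L. x = Z k + Y k \<and> 0 < D (P + Z k) \<and> nmem u ''D'' (Q + x) = Suc (Y k) \<and>
            rmem u ''T'' (Q + x) = cand k" if "x < 2 ^ m" "0 < nmem u ''D'' (Q + x)" for x
        proof (cases "Q + x = q")
          case eq: True
          then show ?thesis
            using True p(1) by (intro exI[of _ l]) (simp add: u_def q_def)
        next
          case False
          then show ?thesis
            using I_ex[OF p(4), of x] that True by (simp add: u_def)
        qed
        moreover have "nmem u ''D'' x = D x \<and> rmem u ''T'' x = T x" if "x < Q \<or> Q + 2 ^ m \<le> x" for x
        proof -
          have "nmem s' ''D'' x = D x \<and> rmem s' ''T'' x = T x"
            using I_out[OF p(4)] that by blast
          then show ?thesis
            using qne[OF that] True by (simp add: u_def)
        qed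
        ultimately show ?thesis
          unfolding I_def by (intro conjI allI impI) (rule; assumption | blast)+
      next
        case False
        then have u: "u = s'" unfolding u_def by (rule if_not_P)
        have step: "0 < nmem s' ''D'' (Q + (Z k + Y k)) \<and> rmem s' ''T'' (Q + (Z k + Y k)) \<le> cand k"
          if k: "k < Suc l" "0 < D (P + Z k)" for k
        proof (cases "k = l")
          case True
          then show ?thesis using False k by (simp add: q_def not_less)
        qed (use I_le[OF p(4)] k in simp)
        note inv = p(4)[unfolded I_def]
        show ?thesis
          unfolding I_def u
          using inv[THEN conjunct1] step inv[THEN conjunct2, THEN conjunct2] by blast
      qed
      then have "I (Suc l) (nwrite ''l'' 0 (Suc l) u)"
        by (simp add: I_def)
      then show ?thesis
        by (cases ?c) (auto simp: fold src q_def[symmetric] cand_def[symmetric] u_def)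
    qed
    subgoal by simp
    subgoal premises p for s'
    proof -
      have "dp_level m g P Q (nmem s' ''D'') (rmem s' ''T'')"
        unfolding dp_level_def
      proof (intro conjI allI impI)
        fix A B assume AB: "A \<subseteq> {..<m}" "B \<subseteq> {..<m}" "A \<inter> B = {}" "0 < nmem s' ''D'' (P + set_encode A)"
        then have "(set_encode A, set_encode B) \<in> disjoint_codes m"
          unfolding disjoint_codes_def by blast
        then obtain l where l: "l < L" "Z l = set_encode A" "Y l = set_encode B"
          unfolding pairs[symmetric] Z_def Y_def by auto
        have "P + set_encode A < Q"
          using set_encode_less[OF AB(1)] PQ by linarith
        then have src: "nmem s' ''D'' (P + Z l) = D (P + Z l)" "rmem s' ''T'' (P + Z l) = T (P + Z l)"
          using I_out[OF p(2), of "P + Z l"] by (simp_all add: l)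
        then have "0 < nmem s' ''D'' (Q + (Z l + Y l)) \<and> rmem s' ''T'' (Q + (Z l + Y l)) \<le> cand l"
          using I_le[OF p(2) l(1)] AB(4) l(2) by simp
        then show "0 < nmem s' ''D'' (Q + set_encode (A \<union> B))"
          "rmem s' ''T'' (Q + set_encode (A \<union> B)) \<le> rmem s' ''T'' (P + set_encode A) + g B"
          using src by (simp_all add: l enc_Un AB cand_def G)
      next
        fix X assume X: "X \<subseteq> {..<m}" "0 < nmem s' ''D'' (Q + set_encode X)"
        then obtain l where l: "l < L" "set_encode X = Z l + Y l" "0 < D (P + Z l)"
          "nmem s' ''D'' (Q + set_encode X) = Suc (Y l)" "rmem s' ''T'' (Q + set_encode X) = cand l"
          using I_ex[OF p(2) set_encode_less[OF X(1)]] by blast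
        obtain A B where AB: "A \<subseteq> {..<m}" "B \<subseteq> {..<m}" "A \<inter> B = {}" "Z l = set_encode A" "Y l = set_encode B"
          using pair[OF l(1)] by blast
        have "P + Z l < Q"
          using ZY[OF l(1)] PQ by linarith
        then have "nmem s' ''D'' (P + Z l) = D (P + Z l)" "rmem s' ''T'' (P + Z l) = T (P + Z l)"
          using I_out[OF p(2)] by simp_all
        moreover have "X = A \<union> B"
        proof -
          have "set_encode X = set_encode (A \<union> B)" using l(2) AB enc_Un by simp
          moreover have "finite X" "finite (A \<union> B)"
            using AB(1,2)[THEN finite_subset] X(1)[THEN finite_subset] by simp_all
          ultimately show ?thesis by (simp add: set_encode_eq)
        qed
        ultimately show "\<exists>A B. X = A \<union> B \<and> A \<inter> B = {} \<and> 0 < nmem s' ''D'' (P + set_encode A) \<and>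
          nmem s' ''D'' (Q + set_encode X) = Suc (set_encode B) \<and>
          rmem s' ''T'' (Q + set_encode X) = rmem s' ''T'' (P + set_encode A) + g B"
          using AB(3-5) l(3-5) G[OF AB(2)] by (intro exI[of _ A] exI[of _ B]) (simp only: cand_def simp_thms)
      qed
      then show ?thesis
        using I_out[OF p(2)] by (simp add: D_def T_def)
    qed
    done
qed

section \<open>Chaining the tables of all colors\<close>

definition compute_levels :: com where
  "compute_levels =
    assign ''prev'' (NConst 0) ;;
    assign ''cur'' (NRead ''PW'' (var ''size'')) ;;
    NWrite ''D'' (NConst 0) (NConst 1) ;;
    For ''i'' (var ''c'')
     (compute_costs ;; relax ;;
      assign ''prev'' (var ''cur'') ;;
      assign ''cur'' (NPlus (var ''cur'') (NRead ''PW'' (var ''size''))))"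

text \<open>Block \<open>n\<close> of the arrays starts at \<open>n * 2 ^ m\<close>, and all blocks
  are kept because the recovery of the coloring reads the choices of every level. In block
  \<open>0\<close> only the empty set is defined: without colors nothing else can be
  covered.\<close>

definition dp_table ::
  "nat \<Rightarrow> (nat \<Rightarrow> nat set \<Rightarrow> rat) \<Rightarrow> nat \<Rightarrow> (nat \<Rightarrow> nat) \<Rightarrow> (nat \<Rightarrow> rat) \<Rightarrow> bool" where
  "dp_table m g n D T \<longleftrightarrow> D 0 = 1 \<and> T 0 = 0 \<and> (\<forall>x<2 ^ m. x \<noteq> 0 \<longrightarrow> D x = 0) \<and>
    (\<forall>i<n. dp_level m (g (Suc i)) (i * 2 ^ m) (Suc i * 2 ^ m) D T)"

text \<open>A level concerns only cells below the end of its target block, so it survives the writes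
  made for later colors.\<close>

lemma dp_level_cong:
  assumes "dp_level m g P Q D T"
    and eq: "\<And>x. x < Q + 2 ^ m \<Longrightarrow> D' x = D x \<and> T' x = T x"
    and PQ: "P \<le> Q"
  shows "dp_level m g P Q D' T'"
proof -
  have P: "D' (P + set_encode A) = D (P + set_encode A)" "T' (P + set_encode A) = T (P + set_encode A)"
    and Q: "D' (Q + set_encode A) = D (Q + set_encode A)" "T' (Q + set_encode A) = T (Q + set_encode A)"
    if "A \<subseteq> {..<m}" for A
    using set_encode_less[OF that] PQ eq[of "P + set_encode A"] eq[of "Q + set_encode A"] by auto
  from assms(1) show ?thesis
    unfolding dp_level_def
    apply (elim conjE)
    apply (intro conjI allI impI)
    subgoal for A B using P[of A] Q[of "A \<union> B"] by simp
    subgoal for A B using P[of A] Q[of "A \<union> B"] by simp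
    subgoal premises p for X
    proof -
      obtain A B where AB: "X = A \<union> B" "A \<inter> B = {}" "0 < D (P + set_encode A)"
        "D (Q + set_encode X) = Suc (set_encode B)" "T (Q + set_encode X) = T (P + set_encode A) + g B"
        using p(2,3,4) Q[of X] by metis
      then show ?thesis
        using p(3) P[of A] Q[of X] by (intro exI[of _ A] exI[of _ B]) auto
    qed
    done
qed

lemma runs_compute_levels:
  assumes s: "nmem s ''size'' 0 = m" "nmem s ''c'' 0 = c" "nmem s ''L'' 0 = 3 ^ m"
    and zero: "rmem s ''G'' = (\<lambda>_. 0)" "rmem s ''T'' = (\<lambda>_. 0)" "nmem s ''D'' = (\<lambda>_. 0)"
    and PW: "\<And>j. j \<le> m \<Longrightarrow> nmem s ''PW'' j = 2 ^ j"
    and RB: "\<And>j. j < m \<Longrightarrow> nmem s ''RB'' j = j * (c + m + 1)"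
    and W: "\<And>j q. j < m \<Longrightarrow> q < c + m + 1 \<Longrightarrow> rmem s ''W'' (j * (c + m + 1) + q) = w j q"
    and pairs: "(\<lambda>l. (nmem s ''PZ'' l, nmem s ''PY'' l)) ` {..<3 ^ m} = disjoint_codes m"
  shows "runs compute_levels s
    (c * (m * (m * (2 ^ m * 3 + 4) + 2 ^ m * 3 + 7) + 3 ^ m * 5 + 8) + 5)
    (\<lambda>s'. nmem s' ''prev'' 0 = c * 2 ^ m \<and> dp_table m (class_cost w c) c (nmem s' ''D'') (rmem s' ''T''))"
proof -
  \<comment> \<open>Zero entries of \<open>D\<close> from the next target block on are the undefined
    targets from which \<open>relax\<close> starts, and \<open>G 0\<close> is the entry on which the
    next cost table is built.\<close>
  define I where "I n s' \<longleftrightarrow> nmem s' ''prev'' 0 = n * 2 ^ m \<and> nmem s' ''cur'' 0 = Suc n * 2 ^ m \<and>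
    rmem s' ''G'' 0 = 0 \<and> (\<forall>x\<ge>Suc n * 2 ^ m. nmem s' ''D'' x = 0) \<and>
    dp_table m (class_cost w c) n (nmem s' ''D'') (rmem s' ''T'')" for n and s' :: state
  let ?tg = "m * (m * (2 ^ m * 3 + 4) + 2 ^ m * 3 + 7) + 2"
  show ?thesis
    unfolding compute_levels_def
    apply simp
    apply (rule runs_For[where n = c and I = I and B = "?tg + (3 ^ m * 5 + 2) + 2"])
    subgoal by (simp add: compute_costs_def relax_def)
    subgoal by (simp add: agreeD s compute_costs_def relax_def)
    subgoal by (simp add: I_def s zero PW dp_table_def)
    subgoal premises p for i s1
    proof -
      note [simp] = agreeD[OF p(2), unfolded compute_costs_def relax_def, simplified] p(3) s
      show ?thesis
        apply (rule runs_Seq[where T = ?tg and T' = "(3 ^ m * 5 + 2) + 2"])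
          apply (rule runs_compute_costs[where m = m and c = c and i = i and w = w])
        subgoal by simp
        subgoal by simp
        subgoal by simp
        subgoal using p(4) by (simp add: I_def)
        subgoal by (rule p(1))
        subgoal by (simp add: PW)
        subgoal by (simp add: RB)
        subgoal using W by simp
        subgoal premises q for s2
        proof -
          note [simp] = agreeD[OF q(1), unfolded compute_costs_def, simplified]
          show ?thesis
            apply (rule runs_Seq[where T = "3 ^ m * 5 + 2" and T' = 2])
              apply (rule runs_relax[where m = m and g = "class_cost w c (Suc i)" and P = "i * 2 ^ m"
                  and Q = "Suc i * 2 ^ m"])
            subgoal by simp
            subgoal using p(4) by (simp add: I_def)
            subgoal using p(4) by (simp add: I_def)
            subgoal by simp
            subgoal using pairs by simp
            subgoal using q(2) by simp
            subgoal using p(4) by (simp add: I_def)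
            subgoal premises r for s3
            proof -
              note [simp] = agreeD[OF r(1), unfolded relax_def, simplified]
              have old: "nmem s3 ''D'' x = nmem s1 ''D'' x \<and> rmem s3 ''T'' x = rmem s1 ''T'' x"
                if "x < Suc i * 2 ^ m \<or> Suc (Suc i) * 2 ^ m \<le> x" for x
                using r(2)[THEN conjunct1, THEN spec, of x] that by auto
              have "dp_table m (class_cost w c) (Suc i) (nmem s3 ''D'') (rmem s3 ''T'')"
                unfolding dp_table_def
              proof (intro conjI allI impI)
                show "nmem s3 ''D'' 0 = 1" "rmem s3 ''T'' 0 = 0"
                  using old[of 0] p(4) by (simp_all add: I_def dp_table_def)
                show "nmem s3 ''D'' x = 0" if "x < 2 ^ m" "x \<noteq> 0" for x
                  using old[of x] p(4) that by (simp add: I_def dp_table_def)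
                show "dp_level m (class_cost w c (Suc k)) (k * 2 ^ m) (Suc k * 2 ^ m) (nmem s3 ''D'') (rmem s3 ''T'')"
                  if k: "k < Suc i" for k
                proof (cases "k = i")
                  case False
                  then have "Suc k \<le> i" using k by simp
                  then have "Suc (Suc k) * 2 ^ m \<le> Suc i * (2 ^ m :: nat)"
                    by (intro mult_le_mono1) simp
                  then have lt: "x < Suc i * 2 ^ m" if "x < Suc k * 2 ^ m + 2 ^ m" for x
                    using that by simp
                  show ?thesis
                    by (rule dp_level_cong[where D = "nmem s1 ''D''" and T = "rmem s1 ''T''"])
                      (use p(4) \<open>Suc k \<le> i\<close> old lt in \<open>simp_all add: I_def dp_table_def\<close>)
                qed (use r(2) in simp)
              qed
              \<comment> \<open>The instance for the empty set gives \<open>G 0 = 0\<close> again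
                for the next color.\<close>
              then show ?thesis
                using p(4) q(2)[rule_format, of "{}"] old by (simp add: I_def PW)
            qed
            subgoal by simp
            done
        qed
        subgoal by simp
        done
    qed
    subgoal by (simp add: algebra_simps)
    subgoal by (simp add: I_def)
    done
qed

section \<open>Recovering an optimal coloring\<close>

lemma dp_level_sound:
  assumes "dp_level m g P Q D T" "X \<subseteq> {..<m}" "0 < D (Q + set_encode X)"
  obtains A B where "X = A \<union> B" "A \<inter> B = {}" "0 < D (P + set_encode A)"
    "D (Q + set_encode X) = Suc (set_encode B)" "T (Q + set_encode X) = T (P + set_encode A) + g B"
  using assms(1)[unfolded dp_level_def, THEN conjunct2, rule_format, OF assms(2,3)] that by blast

text \<open>Any coloring \<open>f\<close> describes a path through the levels along the sets
  \<open>X n\<close> of indices with color at most \<open>n\<close>. Each step adds the class of one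
  color, and the first half of \<open>dp_level\<close> bounds the new entry. Definedness travels
  along the same path.\<close>

lemma dp_table_le:
  assumes dp: "dp_table m g c D T"
    and f: "\<And>j. j < m \<Longrightarrow> f j \<in> {1..c}"
  shows "0 < D (c * 2 ^ m + set_encode {..<m})"
    "T (c * 2 ^ m + set_encode {..<m}) \<le> (\<Sum>i=1..c. g i {j. j < m \<and> f j = i})"
proof -
  define X where "X n = {j. j < m \<and> f j \<le> n}" for n
  have "0 < D (n * 2 ^ m + set_encode (X n)) \<and>
      T (n * 2 ^ m + set_encode (X n)) \<le> (\<Sum>i=1..n. g i {j. j < m \<and> f j = i})" if "n \<le> c" for n
    using that
  proof (induction n)
    case 0
    have "X 0 = {}" using f by (force simp: X_def)
    then show ?case using dp by (simp add: dp_table_def)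
  next
    case (Suc n)
    let ?B = "{j. j < m \<and> f j = Suc n}"
    have X: "X (Suc n) = X n \<union> ?B" "X n \<inter> ?B = {}" "X n \<subseteq> {..<m}" "?B \<subseteq> {..<m}"
      by (auto simp: X_def)
    have "dp_level m (g (Suc n)) (n * 2 ^ m) (Suc n * 2 ^ m) D T"
      using dp Suc.prems by (simp add: dp_table_def)
    then have "0 < D (Suc n * 2 ^ m + set_encode (X n \<union> ?B)) \<and>
        T (Suc n * 2 ^ m + set_encode (X n \<union> ?B)) \<le> T (n * 2 ^ m + set_encode (X n)) + g (Suc n) ?B"
      using X Suc.IH Suc.prems unfolding dp_level_def by (meson Suc_leD)
    moreover have "T (n * 2 ^ m + set_encode (X n)) \<le> (\<Sum>i=1..n. g i {j. j < m \<and> f j = i})"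
      using Suc by simp
    ultimately show ?case
      by (simp add: X(1))
  qed
  from this[of c] have "0 < D (c * 2 ^ m + set_encode (X c)) \<and>
      T (c * 2 ^ m + set_encode (X c)) \<le> (\<Sum>i=1..c. g i {j. j < m \<and> f j = i})" by simp
  moreover have "X c = {..<m}" using f by (auto simp: X_def)
  ultimately show "0 < D (c * 2 ^ m + set_encode {..<m})"
    "T (c * 2 ^ m + set_encode {..<m}) \<le> (\<Sum>i=1..c. g i {j. j < m \<and> f j = i})" by simp_all
qed

abbreviation top_index :: nexp where
  "top_index \<equiv> NMinus (NMinus (var ''size'') (NConst 1)) (var ''l'')"

text \<open>Binary digits are extracted from the top: once the higher ones are removed, an index
  belongs to the set exactly if the remainder is at least its power of two, so comparison and
  subtraction suffice. As the levels are left from the last one downwards, the color belonging to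
  the counter \<open>i\<close> is \<open>c - i\<close>.\<close>

definition paint :: com where
  "paint = For ''l'' (var ''size'')
    (If (NLess (var ''R'') (NRead ''PW'' top_index)) Skip
      (NWrite ''col'' (NRead ''S'' top_index) (NMinus (var ''c'') (var ''i'')) ;;
       assign ''R'' (NMinus (var ''R'') (NRead ''PW'' top_index))))"

lemma runs_paint:
  assumes s: "nmem s ''size'' 0 = m" "nmem s ''R'' 0 = set_encode B"
    and B: "B \<subseteq> {..<m}"
    and PW: "\<And>j. j \<le> m \<Longrightarrow> nmem s ''PW'' j = 2 ^ j"
    and inj: "inj_on (nmem s ''S'') {..<m}"
  shows "runs paint s (m * 5 + 2) (\<lambda>s'.
    (\<forall>j<m. nmem s' ''col'' (nmem s ''S'' j) =
      (if j \<in> B then nmem s ''c'' 0 - nmem s ''i'' 0 else nmem s ''col'' (nmem s ''S'' j))) \<and>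
    (\<forall>u. u \<notin> nmem s ''S'' ` {..<m} \<longrightarrow> nmem s' ''col'' u = nmem s ''col'' u))"
proof -
  define I where "I n s' \<longleftrightarrow> nmem s' ''R'' 0 = set_encode (B \<inter> {..<m - n}) \<and>
    (\<forall>j<m. nmem s' ''col'' (nmem s ''S'' j) =
      (if j \<in> B \<and> m - n \<le> j then nmem s ''c'' 0 - nmem s ''i'' 0 else nmem s ''col'' (nmem s ''S'' j))) \<and>
    (\<forall>u. u \<notin> nmem s ''S'' ` {..<m} \<longrightarrow> nmem s' ''col'' u = nmem s ''col'' u)" for n and s' :: state
  have BI: "B \<inter> {..<m} = B" using B by blast
  show ?thesis
    unfolding paint_def
    apply (rule runs_For[where n = m and I = I and B = 3])
    subgoal by simp
    subgoal by (simp add: agreeD s)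
    subgoal using B by (auto simp: I_def s BI)
    subgoal premises p for n s'
    proof -
      note [simp] = agreeD[OF p(2), simplified] p(3) s
      define j where "j = m - 1 - n"
      have j: "j < m" "m - n = Suc j" "m - Suc n = j" "m - Suc 0 - n = j"
        using p(1) by (auto simp: j_def)
      have ne: "nmem s ''S'' k = nmem s ''S'' j \<longleftrightarrow> k = j" if "k < m" for k
        using inj_onD[OF inj, of k j] j(1) that by auto
      show ?thesis
      proof (cases "j \<in> B")
        case True
        then have "B \<inter> {..<Suc j} = insert j (B \<inter> {..<j})" by (auto simp: less_Suc_eq)
        then have "set_encode (B \<inter> {..<Suc j}) = 2 ^ j + set_encode (B \<inter> {..<j})"
          by (simp add: set_encode_insert_top)
        then show ?thesis
          using p(4) j True ne by (auto simp: I_def PW Suc_le_eq)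
      next
        case False
        then have eq: "B \<inter> {..<Suc j} = B \<inter> {..<j}" by (auto simp: less_Suc_eq)
        \<comment> \<open>The remainder is too small for digit \<open>j\<close>, so the test takes
          the \<open>Skip\<close> branch.\<close>
        have "set_encode (B \<inter> {..<j}) < 2 ^ j" by (intro set_encode_less) simp
        moreover have "k \<in> B \<and> Suc j \<le> k \<longleftrightarrow> k \<in> B \<and> j \<le> k" for k
          using False by (auto simp: Suc_le_eq le_less)
        ultimately show ?thesis
          using p(4) j eq by (simp add: I_def PW)
      qed
    qed
    subgoal by simp
    subgoal by (simp add: I_def)
    done
qed

text \<open>\<open>X\<close> is the code of the set still to be painted, at first all of
  \<open>S\<close>. The entry of \<open>D\<close> minus one is the code of the class of the current
  color, which is part of that set, so the subtraction of codes is a set difference.\<close>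

definition trace_back :: com where
  "trace_back =
    assign ''X'' (NMinus (NRead ''PW'' (var ''size'')) (NConst 1)) ;;
    For ''i'' (var ''c'')
     (assign ''R'' (NMinus (NRead ''D'' (NPlus (var ''prev'') (var ''X''))) (NConst 1)) ;;
      assign ''X'' (NMinus (var ''X'') (var ''R'')) ;;
      assign ''prev'' (NMinus (var ''prev'') (NRead ''PW'' (var ''size''))) ;;
      paint)"

lemma runs_trace_back:
  assumes s: "nmem s ''size'' 0 = m" "nmem s ''c'' 0 = c" "nmem s ''prev'' 0 = c * 2 ^ m"
    and PW: "\<And>j. j \<le> m \<Longrightarrow> nmem s ''PW'' j = 2 ^ j"
    and inj: "inj_on (nmem s ''S'') {..<m}"
    and dp: "dp_table m g c (nmem s ''D'') (rmem s ''T'')"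
    and "1 \<le> c"
  defines "res \<equiv> \<lambda>s' j. nmem s' ''col'' (nmem s ''S'' j)"
  shows "runs trace_back s (c * (m * 5 + 7) + 3) (\<lambda>s'.
    (\<forall>j<m. res s' j \<in> {1..c}) \<and>
    (\<forall>u. u \<notin> nmem s ''S'' ` {..<m} \<longrightarrow> nmem s' ''col'' u = nmem s ''col'' u) \<and>
    (\<forall>f. (\<forall>j<m. f j \<in> {1..c}) \<longrightarrow>
      (\<Sum>i=1..c. g i {j. j < m \<and> res s' j = i}) \<le> (\<Sum>i=1..c. g i {j. j < m \<and> f j = i})))"
proof -
  define D T where "D = nmem s ''D''" and "T = rmem s ''T''"
  note dp = dp[folded D_def T_def]
  define opt where "opt = T (c * 2 ^ m + set_encode {..<m})"
  define cls where "cls s' A i = {j. j < m \<and> j \<notin> A \<and> res s' j = i}" for s' A i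
  \<comment> \<open>The optimum splits into the table value of the unpainted set \<open>A\<close>
    and the costs of the classes painted so far. Indices in \<open>A\<close> are left out of
    \<open>cls\<close> because their cells still hold old contents.\<close>
  define J where "J n s' A \<longleftrightarrow> A \<subseteq> {..<m} \<and> nmem s' ''X'' 0 = set_encode A \<and>
    nmem s' ''prev'' 0 = (c - n) * 2 ^ m \<and> 0 < D ((c - n) * 2 ^ m + set_encode A) \<and>
    (\<forall>j<m. j \<notin> A \<longrightarrow> res s' j \<in> {c - n<..c}) \<and>
    T ((c - n) * 2 ^ m + set_encode A) + (\<Sum>i\<in>{c - n<..c}. g i (cls s' A i)) = opt \<and>
    (\<forall>u. u \<notin> nmem s ''S'' ` {..<m} \<longrightarrow> nmem s' ''col'' u = nmem s ''col'' u)" for n s' A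
  define I where "I n s' \<longleftrightarrow> (\<exists>A. J n s' A)" for n s'
  have full: "0 < D (c * 2 ^ m + set_encode {..<m})"
    using dp_table_le(1)[OF dp, of "\<lambda>_. 1"] \<open>1 \<le> c\<close> by simp
  show ?thesis
    unfolding trace_back_def
    apply simp
    apply (rule runs_For[where n = c and I = I and B = "m * 5 + 5"])
    subgoal by (simp add: paint_def)
    subgoal by (simp add: agreeD s paint_def)
    subgoal
      unfolding I_def using full PW[of m]
      by (intro exI[of _ "{..<m}"]) (simp add: J_def s opt_def set_encode_full)
    subgoal premises p for n s1
    proof -
      note [simp] = agreeD[OF p(2), unfolded paint_def, simplified] p(3) s
      define i where "i = c - Suc n"
      have i: "c - n = Suc i" "Suc i \<le> c" "i < c" using p(1) by (auto simp: i_def)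
      obtain X where X: "J n s1 X" using p(4) I_def by blast
      then have X_sub: "X \<subseteq> {..<m}" by (simp add: J_def)
      have level: "dp_level m (g (Suc i)) (i * 2 ^ m) (Suc i * 2 ^ m) D T"
        using dp i(3) by (simp add: dp_table_def)
      have pos: "0 < D (Suc i * 2 ^ m + set_encode X)"
        using X by (simp add: J_def i)
      obtain A B where AB: "X = A \<union> B" "A \<inter> B = {}" "0 < D (i * 2 ^ m + set_encode A)"
        "D (Suc i * 2 ^ m + set_encode X) = Suc (set_encode B)"
        "T (Suc i * 2 ^ m + set_encode X) = T (i * 2 ^ m + set_encode A) + g (Suc i) B"
        by (rule dp_level_sound[OF level X_sub pos])
      have sub: "A \<subseteq> {..<m}" "B \<subseteq> {..<m}" using X_sub AB(1) by auto
      then have "finite A" "finite B" using finite_subset[OF _ finite_lessThan] by auto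
      then have enc: "set_encode X = set_encode A + set_encode B"
        using AB(1,2) set_encode_Un by simp
      define s2 where "s2 = nwrite ''prev'' 0 (i * 2 ^ m) (nwrite ''X'' 0 (set_encode A)
        (nwrite ''R'' 0 (set_encode B) s1))"
      have s1: "nmem s1 ''prev'' 0 = Suc i * 2 ^ m" "nmem s1 ''X'' 0 = set_encode X"
        using X by (simp_all add: J_def i)
      have DX: "nmem s ''D'' (2 ^ m + i * 2 ^ m + set_encode X) = Suc (set_encode B)"
        using AB(4) by (simp add: D_def)
      have "runs paint s2 (m * 5 + 2) (\<lambda>s3. I (Suc n) (nwrite ''i'' 0 (Suc n) s3))"
        apply (rule runs_mono)
          apply (rule runs_paint[where m = m and B = B])
        subgoal by (simp add: s2_def)
        subgoal by (simp add: s2_def)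
        subgoal by (rule sub)
        subgoal by (simp add: s2_def PW)
        subgoal using inj by (simp add: s2_def)
        subgoal by simp
        subgoal premises q for s3
        proof -
          note [simp] = agreeD[OF q(1), unfolded paint_def, simplified]
          let ?s = "nwrite ''i'' 0 (Suc n) s3"
          have col: "res ?s j = (if j \<in> B then Suc i else res s1 j)" if "j < m" for j
            using q(2) that i by (simp add: s2_def res_def)
          have res1: "res s1 j \<in> {Suc i<..c}" if "j < m" "j \<notin> X" for j
            using X that by (simp add: J_def i)
          \<comment> \<open>Indices outside \<open>X\<close> were painted earlier with colors above
            \<open>Suc i\<close>, so this color now marks precisely the class just painted.\<close>
          have new: "cls ?s A (Suc i) = B"
          proof (rule set_eqI)
            show "j \<in> cls ?s A (Suc i) \<longleftrightarrow> j \<in> B" for j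
              using col[of j] res1[of j] AB(1,2) sub(2) by (cases "j \<in> B") (auto simp: cls_def)
          qed
          have old: "cls ?s A k = cls s1 X k" if "k \<in> {Suc i<..c}" for k
            using that col AB(1) by (auto simp: cls_def)
          have "{i<..c} = insert (Suc i) {Suc i<..c}" using i by auto
          then have "(\<Sum>k\<in>{i<..c}. g k (cls ?s A k)) =
              g (Suc i) B + (\<Sum>k\<in>{Suc i<..c}. g k (cls s1 X k))"
            using old by (simp add: new)
          moreover have "T (Suc i * 2 ^ m + set_encode X) + (\<Sum>k\<in>{Suc i<..c}. g k (cls s1 X k)) = opt"
            using X by (simp add: J_def i)
          ultimately have cost: "T (i * 2 ^ m + set_encode A) + (\<Sum>k\<in>{i<..c}. g k (cls ?s A k)) = opt"
            using AB(5) by simp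
          have "J (Suc n) ?s A"
            unfolding J_def i_def[symmetric]
          proof (intro conjI)
            show "\<forall>j<m. j \<notin> A \<longrightarrow> res ?s j \<in> {i<..c}"
            proof (intro allI impI)
              show "res ?s j \<in> {i<..c}" if "j < m" "j \<notin> A" for j
                using col[of j] res1[of j] AB(1) i(2) that by (cases "j \<in> B") simp_all
            qed
            show "\<forall>u. u \<notin> nmem s ''S'' ` {..<m} \<longrightarrow> nmem ?s ''col'' u = nmem s ''col'' u"
              using q(2) X by (simp add: s2_def J_def)
          qed (use sub AB cost in \<open>simp_all add: s2_def\<close>)
          then show ?thesis by (auto simp: I_def)
        qed
        done
      then show ?thesis
        using s1 DX PW[of m] enc by (simp add: s2_def D_def)
    qed
    subgoal by (simp add: algebra_simps)
    subgoal premises p for s'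
    proof -
      obtain A where A: "J c s' A" using p(2) I_def by blast
      \<comment> \<open>The first block defines no set other than the empty one, so nothing is left
        unpainted.\<close>
      have "A = {}"
      proof (rule ccontr)
        assume "A \<noteq> {}"
        moreover have sub: "A \<subseteq> {..<m}" and pos: "0 < D (set_encode A)" using A by (simp_all add: J_def)
        moreover have "finite A" using finite_subset[OF sub] by simp
        ultimately have "set_encode A \<noteq> 0" "set_encode A < 2 ^ m"
          using set_encode_eq[of A "{}"] set_encode_less[of A m] by auto
        then show False
          using dp pos by (simp add: dp_table_def)
      qed
      have "T 0 = 0" using dp by (simp add: dp_table_def)
      moreover have "{0<..c} = {1..c}" by auto
      ultimately have "(\<Sum>i=1..c. g i {j. j < m \<and> res s' j = i}) = opt"
        using A \<open>A = {}\<close> by (simp add: J_def cls_def)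
      moreover have "res s' j \<in> {1..c}" if "j < m" for j
        using A \<open>A = {}\<close> that by (auto simp: J_def)
      moreover have "nmem s' ''col'' u = nmem s ''col'' u" if "u \<notin> nmem s ''S'' ` {..<m}" for u
        using A that by (auto simp: J_def)
      moreover have "opt \<le> (\<Sum>i=1..c. g i {j. j < m \<and> f j = i})" if "\<forall>j<m. f j \<in> {1..c}" for f
        using dp_table_le(2)[OF dp, of f] that by (simp add: opt_def)
      ultimately show ?thesis by simp
    qed
    done
qed

section \<open>Weight of the cut in terms of class costs\<close>

lemma finite_edges: "graph V E \<Longrightarrow> finite E"
  unfolding graph_def by (meson Pow_iff finite_Pow_iff finite_subset subsetI)

lemma finite_neighbours: "graph V E \<Longrightarrow> finite (neighbours E v)"
proof -
  assume "graph V E"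
  then have "neighbours E v \<subseteq> V" "finite V"
    by (auto simp: graph_def neighbours_def)
  then show ?thesis by (rule finite_subset)
qed

lemma neighbour_in_V: "graph V E \<Longrightarrow> u \<in> neighbours E v \<Longrightarrow> u \<in> V \<and> u \<noteq> v"
  by (auto simp: graph_def neighbours_def)

text \<open>\<open>U j\<close> expresses the charging through neighbours: excluding the vertices
  with index at least \<open>j\<close> leaves other ends that lie outside the enumerated set or have
  a smaller index. This makes the edge sets \<open>F j\<close> disjoint, and the largest index on an
  edge shows that they cover.\<close>

lemma mono_edges_decomposition:
  fixes sv :: "nat \<Rightarrow> 'v"
  assumes G: "graph V E" and inj: "inj_on sv {..<m}"
    and U: "\<And>j. U j = {u \<in> neighbours E (sv j). u \<notin> sv ` {j..<m} \<and> \<chi> u = \<chi> (sv j)}"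
  shows "weight \<omega> (E - cut_edges E \<chi>) = weight \<omega> {e \<in> E - cut_edges E \<chi>. e \<inter> sv ` {..<m} = {}} +
    (\<Sum>j<m. \<Sum>u\<in>U j. \<omega> {sv j, u})"
proof -
  define F0 where "F0 = {e \<in> E - cut_edges E \<chi>. e \<inter> sv ` {..<m} = {}}"
  define F where "F j = (\<lambda>u. {sv j, u}) ` U j" for j
  have fin: "finite E" using finite_edges G by blast
  have finU: "finite (U j)" for j
    using finite_neighbours[OF G] by (simp add: U)
  have svne: "sv j = sv k \<longleftrightarrow> j = k" if "j < m" "k < m" for j k
    using inj_on_eq_iff[OF inj] that by simp
  have F_sub: "F j \<subseteq> E - cut_edges E \<chi>" if "j < m" for j
  proof
    fix e assume "e \<in> F j"
    then obtain u where u: "e = {sv j, u}" "u \<in> neighbours E (sv j)" "\<chi> u = \<chi> (sv j)"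
      by (auto simp: F_def U)
    have "e \<in> E" using u(1,2) by (simp add: neighbours_def insert_commute)
    moreover have "e \<notin> cut_edges E \<chi>"
      using u(1,3) by (auto simp: cut_edges_def doubleton_eq_iff)
    ultimately show "e \<in> E - cut_edges E \<chi>" by simp
  qed
  have disj: "F j \<inter> F k = {}" if "j < m" "k < m" "j < k" for j k
  proof (rule ccontr)
    assume "F j \<inter> F k \<noteq> {}"
    then obtain u v where uv: "u \<in> U j" "{sv j, u} = {sv k, v}" by (auto simp: F_def)
    have "sv j \<noteq> sv k" using svne[OF that(1,2)] that(3) by auto
    then have "u = sv k" using uv(2) by (auto simp: doubleton_eq_iff)
    moreover have "sv k \<in> sv ` {j..<m}" using that by auto
    ultimately show False using uv(1) by (simp add: U)
  qed
  have disj': "F j \<inter> F k = {}" if "j < m" "k < m" "j \<noteq> k" for j k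
    using disj[of j k] disj[of k j] that by (cases "j < k") auto
  have cover: "E - cut_edges E \<chi> = F0 \<union> (\<Union>j<m. F j)"
  proof
    show "F0 \<union> (\<Union>j<m. F j) \<subseteq> E - cut_edges E \<chi>"
      using F_sub by (auto simp: F0_def)
    show "E - cut_edges E \<chi> \<subseteq> F0 \<union> (\<Union>j<m. F j)"
    proof
      fix e assume e: "e \<in> E - cut_edges E \<chi>"
      show "e \<in> F0 \<union> (\<Union>j<m. F j)"
      proof (cases "e \<inter> sv ` {..<m} = {}")
        case True
        then show ?thesis using e by (simp add: F0_def)
      next
        case False
        define J where "J = {j. j < m \<and> sv j \<in> e}"
        have J: "finite J" "J \<noteq> {}" using False by (auto simp: J_def)
        define j where "j = Max J"
        have jJ: "j < m" "sv j \<in> e" using Max_in[OF J] by (auto simp: j_def J_def)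
        have "card e = 2" using e G by (simp add: graph_def)
        then obtain u where u: "e = {sv j, u}" "u \<noteq> sv j"
          using jJ(2) by (auto simp: card_2_iff)
        have "u \<notin> sv ` {j..<m}"
        proof
          assume "u \<in> sv ` {j..<m}"
          then obtain k where k: "u = sv k" "j \<le> k" "k < m" by auto
          then have "k \<in> J" using u(1) by (simp add: J_def)
          then have "k \<le> j" unfolding j_def using J(1) by (rule Max_ge[rotated])
          then show False using k u(2) by simp
        qed
        moreover have "\<chi> u = \<chi> (sv j)"
          using e u(1) unfolding cut_edges_def by blast
        moreover have "u \<in> neighbours E (sv j)"
          using e u(1) by (simp add: neighbours_def insert_commute)
        ultimately show ?thesis using jJ(1) u(1) by (auto simp: F_def U)
      qed
    qed
  qed
  have finF: "finite (F j)" for j using finU by (simp add: F_def)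
  have "F0 \<inter> (\<Union>j<m. F j) = {}" by (auto simp: F0_def F_def)
  then have "weight \<omega> (E - cut_edges E \<chi>) = weight \<omega> F0 + (\<Sum>e\<in>(\<Union>j<m. F j). \<omega> e)"
    unfolding weight_def cover using fin finF by (intro sum.union_disjoint) (auto simp: F0_def)
  also have "(\<Sum>e\<in>(\<Union>j<m. F j). \<omega> e) = (\<Sum>j<m. \<Sum>e\<in>F j. \<omega> e)"
    using finF disj' by (intro sum.UNION_disjoint) auto
  also have "\<dots> = (\<Sum>j<m. \<Sum>u\<in>U j. \<omega> {sv j, u})"
    unfolding F_def by (intro sum.cong refl sum.reindex_cong) (auto simp: inj_on_def doubleton_eq_iff)
  finally show ?thesis by (simp add: F0_def)
qed

text \<open>\<open>\<kappa>\<close> is the coloring with the private colors written into it. Real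
  colors are at most \<open>c\<close>, so key \<open>i\<close> collects only neighbours outside the
  enumerated set, and key \<open>c + 1 + l\<close> only the vertex of index \<open>l\<close>, if it
  is adjacent.\<close>

lemma sum_new_neighbours:
  assumes G: "graph V E" and inj: "inj_on sv {..<m}"
    and \<kappa>: "\<And>j. j < m \<Longrightarrow> \<kappa> (sv j) = c + 1 + j" "\<And>u. u \<in> V \<Longrightarrow> u \<notin> sv ` {..<m} \<Longrightarrow> \<kappa> u = \<chi>' u"
    and col: "coloring V c \<chi>'" and V: "sv ` {..<m} \<subseteq> V"
    and w: "\<And>q. w j q = (\<Sum>u | u \<in> neighbours E (sv j) \<and> \<kappa> u = q. \<omega> {sv j, u})"
    and j: "j < m" "\<chi>' (sv j) = i"
  shows "(\<Sum>u\<in>{u \<in> neighbours E (sv j). u \<notin> sv ` {j..<m} \<and> \<chi>' u = \<chi>' (sv j)}. \<omega> {sv j, u}) =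
    w j i + (\<Sum>l\<in>{l. l < m \<and> \<chi>' (sv l) = i} \<inter> {..<j}. w j (c + 1 + l))"
proof -
  define N where "N q = {u \<in> neighbours E (sv j). \<kappa> u = q}" for q
  define A where "A = {l. l < m \<and> \<chi>' (sv l) = i} \<inter> {..<j}"
  have fin: "finite (N q)" for q
    using finite_neighbours[OF G] by (simp add: N_def)
  have ic: "i \<le> c" using col V j by (auto simp: coloring_def)
  have svne: "sv l = sv k \<longleftrightarrow> l = k" if "l < m" "k < m" for l k
    using inj_on_eq_iff[OF inj] that by simp
  have "u \<in> neighbours E (sv j) \<and> u \<notin> sv ` {j..<m} \<and> \<chi>' u = i \<longleftrightarrow>
      u \<in> N i \<union> (\<Union>l\<in>A. N (c + 1 + l))" for u
  proof (cases "u \<in> sv ` {..<m}")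
    case True
    then obtain l where l: "l < m" "u = sv l" by auto
    have "u \<in> sv ` {j..<m} \<longleftrightarrow> j \<le> l" using l svne by auto
    moreover have "\<kappa> u = c + 1 + l" using \<kappa>(1)[OF l(1)] l(2) by simp
    then have "u \<in> N i \<union> (\<Union>l\<in>A. N (c + 1 + l)) \<longleftrightarrow> u \<in> neighbours E (sv j) \<and> l \<in> A"
      using ic by (auto simp: N_def)
    ultimately show ?thesis using l by (auto simp: A_def)
  next
    case False
    then have "u \<notin> sv ` {j..<m}" by auto
    moreover have "\<kappa> u = \<chi>' u" "\<chi>' u \<le> c" if "u \<in> neighbours E (sv j)"
      using \<kappa>(2)[OF _ False] neighbour_in_V[OF G that] col by (auto simp: coloring_def)
    ultimately show ?thesis by (auto simp: N_def)
  qed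
  then have "{u \<in> neighbours E (sv j). u \<notin> sv ` {j..<m} \<and> \<chi>' u = \<chi>' (sv j)} =
      N i \<union> (\<Union>l\<in>A. N (c + 1 + l))"
    using j(2) by auto
  then have "(\<Sum>u\<in>{u \<in> neighbours E (sv j). u \<notin> sv ` {j..<m} \<and> \<chi>' u = \<chi>' (sv j)}. \<omega> {sv j, u}) =
      (\<Sum>u\<in>N i \<union> (\<Union>l\<in>A. N (c + 1 + l)). \<omega> {sv j, u})" by simp
  also have "\<dots> = (\<Sum>u\<in>N i. \<omega> {sv j, u}) + (\<Sum>u\<in>(\<Union>l\<in>A. N (c + 1 + l)). \<omega> {sv j, u})"
    using fin ic by (intro sum.union_disjoint) (auto simp: A_def N_def)
  also have "(\<Sum>u\<in>(\<Union>l\<in>A. N (c + 1 + l)). \<omega> {sv j, u}) = (\<Sum>l\<in>A. \<Sum>u\<in>N (c + 1 + l). \<omega> {sv j, u})"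
    using fin by (intro sum.UNION_disjoint) (auto simp: A_def N_def)
  finally show ?thesis
    by (simp add: w N_def A_def)
qed

text \<open>Edges avoiding \<open>S\<close> keep their status because flips happen inside
  \<open>S\<close>. The first two terms are therefore the same for all admissible
  \<open>\<chi>'\<close>, and only the class costs remain to be minimized.\<close>

lemma weight_cut_edges:
  assumes G: "graph V E" and inj: "inj_on sv {..<m}" and V: "sv ` {..<m} \<subseteq> V"
    and \<kappa>: "\<And>j. j < m \<Longrightarrow> \<kappa> (sv j) = c + 1 + j" "\<And>u. u \<in> V \<Longrightarrow> u \<notin> sv ` {..<m} \<Longrightarrow> \<kappa> u = \<chi> u"
    and w: "\<And>j q. j < m \<Longrightarrow> w j q = (\<Sum>u | u \<in> neighbours E (sv j) \<and> \<kappa> u = q. \<omega> {sv j, u})"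
    and col: "coloring V c \<chi>'" and flip: "D_flip V \<chi> \<chi>' \<subseteq> sv ` {..<m}"
  shows "weight \<omega> (cut_edges E \<chi>') = weight \<omega> E -
    weight \<omega> {e \<in> E - cut_edges E \<chi>. e \<inter> sv ` {..<m} = {}} -
    (\<Sum>i=1..c. class_cost w c i {j. j < m \<and> \<chi>' (sv j) = i})"
proof -
  have same: "\<chi>' u = \<chi> u" if "u \<in> V" "u \<notin> sv ` {..<m}" for u
    using flip that by (auto simp: D_flip_def)
  have outer: "{e \<in> E - cut_edges E \<chi>'. e \<inter> sv ` {..<m} = {}} =
      {e \<in> E - cut_edges E \<chi>. e \<inter> sv ` {..<m} = {}}"
  proof -
    have "e \<in> cut_edges E \<chi>' \<longleftrightarrow> e \<in> cut_edges E \<chi>" if "e \<in> E" "e \<inter> sv ` {..<m} = {}" for e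
    proof -
      have "\<chi>' u = \<chi> u" if "u \<in> e" for u
        using same[of u] that \<open>e \<in> E\<close> \<open>e \<inter> _ = {}\<close> G by (auto simp: graph_def)
      then have "(\<exists>u v. e = {u, v} \<and> \<chi>' u \<noteq> \<chi>' v) \<longleftrightarrow> (\<exists>u v. e = {u, v} \<and> \<chi> u \<noteq> \<chi> v)"
        by (metis insertCI)
      then show ?thesis by (simp add: cut_edges_def)
    qed
    then show ?thesis by blast
  qed
  define h where "h j i = w j i + (\<Sum>l\<in>{l. l < m \<and> \<chi>' (sv l) = i} \<inter> {..<j}. w j (c + 1 + l))" for j i
  have "(\<Sum>u\<in>{u \<in> neighbours E (sv j). u \<notin> sv ` {j..<m} \<and> \<chi>' u = \<chi>' (sv j)}. \<omega> {sv j, u}) =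
      h j (\<chi>' (sv j))" if "j < m" for j
    unfolding h_def
    by (rule sum_new_neighbours[OF G inj, where \<kappa> = \<kappa>]) (use \<kappa> same col V w that in simp_all)
  then have "weight \<omega> (E - cut_edges E \<chi>') =
      weight \<omega> {e \<in> E - cut_edges E \<chi>. e \<inter> sv ` {..<m} = {}} + (\<Sum>j<m. h j (\<chi>' (sv j)))"
    using mono_edges_decomposition[OF G inj refl, of \<omega> \<chi>', unfolded outer] by simp
  \<comment> \<open>Grouping the charges of the vertices by their color turns them into costs of
    classes.\<close>
  also have "(\<Sum>j<m. h j (\<chi>' (sv j))) =
      (\<Sum>i=1..c. \<Sum>j\<in>{j \<in> {..<m}. \<chi>' (sv j) = i}. h j (\<chi>' (sv j)))"
    using V col by (intro sum.group[symmetric]) (auto simp: coloring_def)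
  also have "\<dots> = (\<Sum>i=1..c. class_cost w c i {j. j < m \<and> \<chi>' (sv j) = i})"
    unfolding class_cost_def h_def by (intro sum.cong) auto
  finally have "weight \<omega> (E - cut_edges E \<chi>') = weight \<omega> {e \<in> E - cut_edges E \<chi>. e \<inter> sv ` {..<m} = {}} +
      (\<Sum>i=1..c. class_cost w c i {j. j < m \<and> \<chi>' (sv j) = i})" .
  moreover have "weight \<omega> (E - cut_edges E \<chi>') = weight \<omega> E - weight \<omega> (cut_edges E \<chi>')"
    unfolding weight_def using finite_edges[OF G] by (intro sum_diff) (auto simp: cut_edges_def)
  ultimately show ?thesis by simp
qed

section \<open>The algorithm\<close>

text \<open>The guard serves the empty \<open>S\<close>: the loops over the colors would take time
  proportional to \<open>c\<close>, whereas \<open>k = 0\<close> allows only a constant.\<close>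

definition solve :: com where
  "solve = If (NLess (NConst 0) (var ''size''))
    (prepare ;; collect_weights ;; list_pairs ;; compute_levels ;; trace_back) Skip"

text \<open>Bracketed to the right like the program, so that each use of \<open>runs_Seq\<close>
  splits it by reflexivity.\<close>

definition solve_time :: "nat \<Rightarrow> nat \<Rightarrow> nat \<Rightarrow> nat" where
  "solve_time m c d = (m * 5 + 3) + ((m * (d * 3 + 4) + 2) + ((m * (3 ^ m * 6 + 5) + 3) +
    ((c * (m * (m * (2 ^ m * 3 + 4) + 2 ^ m * 3 + 7) + 3 ^ m * 5 + 8) + 5) + (c * (m * 5 + 7) + 3))))"

text \<open>Since \<open>m\<close> and \<open>c\<close> are positive, each monomial without
  \<open>d\<close> is at most \<open>a\<close>. The coefficients of these monomials, with the step
  for the guard, add up to 79, which \<open>100\<close> covers.\<close>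

lemma solve_time_le:
  assumes "1 \<le> m" "1 \<le> c" "m \<le> k"
  shows "solve_time m c d + 1 \<le> 100 * (3 ^ k * c * k\<^sup>2 + k * d)"
proof -
  define a where "a = 3 ^ m * c * m\<^sup>2"
  have two: "(2::nat) ^ m \<le> 3 ^ m" by (rule power_mono) simp_all
  have bound: "x * y * z \<le> a" if "x \<le> 3 ^ m" "y \<le> c" "z \<le> m\<^sup>2" for x y z
    unfolding a_def using that by (intro mult_mono) simp_all
  have m: "m \<le> m\<^sup>2" "1 \<le> m\<^sup>2" "m * m \<le> m\<^sup>2" using assms by (simp_all add: power2_eq_square)
  have p: "(1::nat) \<le> 3 ^ m" by simp
  have "1 \<le> a" "m \<le> a" "c \<le> a" "c * m \<le> a" "c * (m * m) \<le> a" "m * 3 ^ m \<le> a" "c * 3 ^ m \<le> a"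
    "c * (m * 2 ^ m) \<le> a" "c * (m * (m * 2 ^ m)) \<le> a"
    using bound[of 1 1 1] bound[of 1 1 m] bound[of 1 c 1] bound[of 1 c m] bound[of 1 c "m * m"]
      bound[of "3 ^ m" 1 m] bound[of "3 ^ m" c 1] bound[of "2 ^ m" c m] bound[of "2 ^ m" c "m * m"]
      two m p assms(2) by (simp_all add: ac_simps)
  then have "solve_time m c d + 1 \<le> 100 * a + 3 * (m * d)"
    unfolding solve_time_def by (simp add: algebra_simps)
  moreover have "a \<le> 3 ^ k * c * k\<^sup>2" "m * d \<le> k * d"
    unfolding a_def using assms by (auto intro!: mult_mono power_increasing power_mono)
  ultimately show ?thesis
    unfolding distrib_left by linarith
qed

lemma runs_solve:
  assumes G: "graph V E" and col: "coloring V c \<chi>" and SV: "S \<subseteq> V"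
    and enc: "encodes s V E \<omega> c \<chi> S" and m: "card S = m" "1 \<le> m"
  shows "runs solve s (solve_time m c (max_degree V E) + 1) (\<lambda>s'.
    coloring V c (output_coloring s') \<and> D_flip V \<chi> (output_coloring s') \<subseteq> S \<and>
    (\<forall>\<chi>''. coloring V c \<chi>'' \<and> D_flip V \<chi> \<chi>'' \<subseteq> S \<longrightarrow>
      weight \<omega> (cut_edges E \<chi>'') \<le> weight \<omega> (cut_edges E (output_coloring s'))))"
proof -
  define sv where "sv = nmem s ''S''"
  define d where "d = max_degree V E"
  have s: "nmem s ''size'' 0 = m" "nmem s ''c'' 0 = c"
    and zeroN: "\<And>x. x \<notin> input_arrays \<Longrightarrow> nmem s x = (\<lambda>_. 0)"
    and zeroR: "\<And>x. x \<noteq> ''wt'' \<Longrightarrow> rmem s x = (\<lambda>_. 0)"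
    and bij: "bij_betw sv {..<m} S"
    and colV: "\<And>v. v \<in> V \<Longrightarrow> nmem s ''col'' v = \<chi> v"
    and deg: "\<And>v. v \<in> V \<Longrightarrow> nmem s ''deg'' v = degree E v"
    and adj: "\<And>v. v \<in> V \<Longrightarrow>
      bij_betw (\<lambda>p. nmem s ''adj'' (nmem s ''start'' v + p)) {..<degree E v} (neighbours E v)"
    and wt: "\<And>v p. v \<in> V \<Longrightarrow> p < degree E v \<Longrightarrow> rmem s ''wt'' (nmem s ''start'' v + p) =
      \<omega> {v, nmem s ''adj'' (nmem s ''start'' v + p)}"
    using enc m(1) unfolding encodes_def sv_def by simp_all
  note zeroN = zeroN[unfolded input_arrays_def]
  have inj: "inj_on sv {..<m}" and img: "sv ` {..<m} = S"
    using bij by (auto simp: bij_betw_def)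
  have svV: "sv j \<in> V" if "j < m" for j using img SV that by blast
  have "finite V" using G by (simp add: graph_def)
  have deg_le: "degree E v \<le> d" if "v \<in> V" for v
    unfolding d_def max_degree_def using that \<open>finite V\<close> by (intro Max_ge) auto
  have "1 \<le> c"
    using col svV[of 0] m(2) by (auto simp: coloring_def)
  define nb where "nb j p = nmem s ''adj'' (nmem s ''start'' (sv j) + p)" for j p
  define K where "K = c + m + 1"
  define good where "good s' \<longleftrightarrow> coloring V c (output_coloring s') \<and>
    D_flip V \<chi> (output_coloring s') \<subseteq> S \<and>
    (\<forall>\<chi>''. coloring V c \<chi>'' \<and> D_flip V \<chi> \<chi>'' \<subseteq> S \<longrightarrow>
      weight \<omega> (cut_edges E \<chi>'') \<le> weight \<omega> (cut_edges E (output_coloring s')))" for s'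
  have "runs (prepare ;; collect_weights ;; list_pairs ;; compute_levels ;; trace_back) s
    (solve_time m c d) good"
    unfolding solve_time_def
  proof (rule runs_Seq[OF runs_prepare[of s m c] _ order_refl])
    show "nmem s ''size'' 0 = m" "nmem s ''c'' 0 = c" "nmem s ''RB'' 0 = 0"
      using s zeroN[of "''RB''"] by simp_all
    show "inj_on (nmem s ''S'') {..<m}" using inj by (simp add: sv_def)
    fix s1 assume ag: "agree prepare s s1"
      and s1: "(\<forall>j\<le>m. nmem s1 ''RB'' j = j * (c + m + 1)) \<and> (\<forall>j\<le>m. nmem s1 ''PW'' j = 2 ^ j) \<and>
        (\<forall>j<m. nmem s1 ''col'' (nmem s ''S'' j) = c + 1 + j) \<and>
        (\<forall>u. u \<notin> nmem s ''S'' ` {..<m} \<longrightarrow> nmem s1 ''col'' u = nmem s ''col'' u)"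
    note [simp] = agreeD[OF ag, unfolded prepare_def, simplified]
    define \<kappa> where "\<kappa> = nmem s1 ''col''"
    have \<kappa>S: "\<kappa> (sv j) = c + 1 + j" if "j < m" for j
      using s1 that by (simp add: \<kappa>_def sv_def)
    have \<kappa>V: "\<kappa> u = \<chi> u" if "u \<in> V" "u \<notin> sv ` {..<m}" for u
      using s1 that colV by (simp add: \<kappa>_def sv_def)
    have \<kappa>_less: "\<kappa> u < K" if "u \<in> V" for u
    proof (cases "u \<in> sv ` {..<m}")
      case True
      then show ?thesis using \<kappa>S by (auto simp: K_def)
    next
      case False
      then show ?thesis using \<kappa>V[OF that] col that by (force simp: coloring_def K_def)
    qed
    have nbV: "nb j p \<in> V" if "j < m" "p < degree E (sv j)" for j p
      using bij_betwE[OF adj[OF svV[OF that(1)]]] that neighbour_in_V[OF G] by (auto simp: nb_def)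
    define w where "w j q = (\<Sum>p | p < degree E (sv j) \<and> \<kappa> (nb j p) = q. rmem s ''wt'' (nmem s ''start'' (sv j) + p))" for j q
    \<comment> \<open>The machine sums over positions in adjacency lists, the cut formula over
      neighbours; the encoding matches the two bijectively.\<close>
    have w: "w j q = (\<Sum>u | u \<in> neighbours E (sv j) \<and> \<kappa> u = q. \<omega> {sv j, u})" if "j < m" for j q
    proof -
      have b: "bij_betw (nb j) {..<degree E (sv j)} (neighbours E (sv j))"
        using adj[OF svV[OF that]] by (simp add: nb_def[abs_def])
      have "bij_betw (nb j) {p. p < degree E (sv j) \<and> \<kappa> (nb j p) = q}
          {u. u \<in> neighbours E (sv j) \<and> \<kappa> u = q}"
        using b by (auto simp: bij_betw_def inj_on_def image_iff)
      then have "(\<Sum>u | u \<in> neighbours E (sv j) \<and> \<kappa> u = q. \<omega> {sv j, u}) =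
          (\<Sum>p | p < degree E (sv j) \<and> \<kappa> (nb j p) = q. \<omega> {sv j, nb j p})"
        by (rule sum.reindex_bij_betw[symmetric])
      also have "\<dots> = w j q"
        unfolding w_def using wt[OF svV[OF that]] by (intro sum.cong) (auto simp: nb_def)
      finally show ?thesis by simp
    qed
    show "runs (collect_weights ;; list_pairs ;; compute_levels ;; trace_back) s1
      ((m * (d * 3 + 4) + 2) + ((m * (3 ^ m * 6 + 5) + 3) +
      ((c * (m * (m * (2 ^ m * 3 + 4) + 2 ^ m * 3 + 7) + 3 ^ m * 5 + 8) + 5) + (c * (m * 5 + 7) + 3)))) good"
    proof (rule runs_Seq[OF runs_collect_weights[of s1 m K d] _ order_refl])
      show "nmem s1 ''size'' 0 = m" "rmem s1 ''W'' = (\<lambda>_. 0)"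
        using s zeroR by simp_all
      show "nmem s1 ''RB'' j = j * K" if "j < m" for j
        using s1 that by (simp add: K_def)
      show "nmem s1 ''deg'' (nmem s1 ''S'' j) \<le> d" if "j < m" for j
        using deg_le svV[OF that] deg by (simp add: sv_def)
      show "nmem s1 ''col'' (nmem s1 ''adj'' (nmem s1 ''start'' (nmem s1 ''S'' j) + p)) < K"
        if "j < m" "p < nmem s1 ''deg'' (nmem s1 ''S'' j)" for j p
        using \<kappa>_less[OF nbV[OF that(1)]] that(2) deg[OF svV[OF that(1)]] by (simp add: \<kappa>_def nb_def sv_def)
      fix s2 assume ag2: "agree collect_weights s1 s2"
        and s2: "\<forall>j<m. \<forall>q<K. rmem s2 ''W'' (j * K + q) =
          (\<Sum>p | p < nmem s1 ''deg'' (nmem s1 ''S'' j) \<and>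
            nmem s1 ''col'' (nmem s1 ''adj'' (nmem s1 ''start'' (nmem s1 ''S'' j) + p)) = q.
            rmem s1 ''wt'' (nmem s1 ''start'' (nmem s1 ''S'' j) + p))"
      have W: "rmem s2 ''W'' (j * K + q) = w j q" if "j < m" "q < K" for j q
        using s2 that deg[OF svV[OF that(1)]] by (simp add: w_def nb_def sv_def \<kappa>_def)
      note [simp] = agreeD[OF ag2, unfolded collect_weights_def, simplified]
      show "runs (list_pairs ;; compute_levels ;; trace_back) s2 ((m * (3 ^ m * 6 + 5) + 3) +
        ((c * (m * (m * (2 ^ m * 3 + 4) + 2 ^ m * 3 + 7) + 3 ^ m * 5 + 8) + 5) + (c * (m * 5 + 7) + 3))) good"
      proof (rule runs_Seq[OF runs_list_pairs[of s2 m] _ order_refl])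
        show "nmem s2 ''size'' 0 = m" "nmem s2 ''PZ'' = (\<lambda>_. 0)" "nmem s2 ''PY'' = (\<lambda>_. 0)"
          using s zeroN by simp_all
        show "nmem s2 ''PW'' j = 2 ^ j" if "j < m" for j
          using s1 that by simp
        fix s3 assume ag3: "agree list_pairs s2 s3"
          and s3: "nmem s3 ''L'' 0 = 3 ^ m \<and>
            (\<lambda>l. (nmem s3 ''PZ'' l, nmem s3 ''PY'' l)) ` {..<3 ^ m} = disjoint_codes m"
        note [simp] = agreeD[OF ag3, unfolded list_pairs_def, simplified]
        show "runs (compute_levels ;; trace_back) s3
          ((c * (m * (m * (2 ^ m * 3 + 4) + 2 ^ m * 3 + 7) + 3 ^ m * 5 + 8) + 5) + (c * (m * 5 + 7) + 3)) good"
        proof (rule runs_Seq[OF runs_compute_levels[of s3 m c w] _ order_refl])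
          show "nmem s3 ''size'' 0 = m" "nmem s3 ''c'' 0 = c" "nmem s3 ''L'' 0 = 3 ^ m"
            "rmem s3 ''G'' = (\<lambda>_. 0)" "rmem s3 ''T'' = (\<lambda>_. 0)" "nmem s3 ''D'' = (\<lambda>_. 0)"
            "(\<lambda>l. (nmem s3 ''PZ'' l, nmem s3 ''PY'' l)) ` {..<3 ^ m} = disjoint_codes m"
            using s s3 zeroN zeroR by simp_all
          show "nmem s3 ''PW'' j = 2 ^ j" if "j \<le> m" for j
            using s1 that by simp
          show "nmem s3 ''RB'' j = j * (c + m + 1)" if "j < m" for j
            using s1 that by simp
          show "rmem s3 ''W'' (j * (c + m + 1) + q) = w j q" if "j < m" "q < c + m + 1" for j q
            using W that by (simp add: K_def)
          fix s4 assume ag4: "agree compute_levels s3 s4"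
            and s4: "nmem s4 ''prev'' 0 = c * 2 ^ m \<and> dp_table m (class_cost w c) c (nmem s4 ''D'') (rmem s4 ''T'')"
          note [simp] = agreeD[OF ag4, unfolded compute_levels_def compute_costs_def relax_def, simplified]
          show "runs trace_back s4 (c * (m * 5 + 7) + 3) good"
          proof (rule runs_mono[OF runs_trace_back[of s4 m c "class_cost w c"] order_refl])
            show "nmem s4 ''size'' 0 = m" "nmem s4 ''c'' 0 = c" "nmem s4 ''prev'' 0 = c * 2 ^ m"
              "inj_on (nmem s4 ''S'') {..<m}"
              "dp_table m (class_cost w c) c (nmem s4 ''D'') (rmem s4 ''T'')" "1 \<le> c"
              using s s4 inj \<open>1 \<le> c\<close> by (simp_all add: sv_def)
            show "nmem s4 ''PW'' j = 2 ^ j" if "j \<le> m" for j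
              using s1 that by simp
            fix s5 :: state
            assume res: "(\<forall>j<m. nmem s5 ''col'' (nmem s4 ''S'' j) \<in> {1..c}) \<and>
              (\<forall>u. u \<notin> nmem s4 ''S'' ` {..<m} \<longrightarrow> nmem s5 ''col'' u = nmem s4 ''col'' u) \<and>
              (\<forall>f. (\<forall>j<m. f j \<in> {1..c}) \<longrightarrow>
                (\<Sum>i=1..c. class_cost w c i {j. j < m \<and> nmem s5 ''col'' (nmem s4 ''S'' j) = i}) \<le>
                (\<Sum>i=1..c. class_cost w c i {j. j < m \<and> f j = i}))"
            define out where "out = output_coloring s5"
            \<comment> \<open>No stage since \<open>prepare\<close> has written \<open>col\<close>.
              It still agrees with \<open>\<chi>\<close> on \<open>V\<close> outside
              \<open>S\<close>, and painting replaces every private color.\<close>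
            have S4: "nmem s4 ''S'' = sv" "nmem s4 ''col'' = \<kappa>" by (simp_all add: sv_def \<kappa>_def)
            have outS: "out (sv j) \<in> {1..c}" if "j < m" for j
              using res that unfolding S4 out_def output_coloring_def by blast
            have outV: "out u = \<chi> u" if "u \<in> V" "u \<notin> sv ` {..<m}" for u
              using res \<kappa>V[OF that] that unfolding S4 out_def output_coloring_def by simp
            have opt: "(\<Sum>i=1..c. class_cost w c i {j. j < m \<and> out (sv j) = i}) \<le>
                (\<Sum>i=1..c. class_cost w c i {j. j < m \<and> f j = i})" if "\<forall>j<m. f j \<in> {1..c}" for f
              using res that unfolding S4 out_def output_coloring_def by blast
            have col_out: "coloring V c out"
              unfolding coloring_def
            proof
              show "out v \<in> {1..c}" if "v \<in> V" for v
                using outS outV[OF that] col that by (cases "v \<in> sv ` {..<m}") (auto simp: coloring_def)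
            qed
            have flip_out: "D_flip V \<chi> out \<subseteq> S"
              using outV img by (auto simp: D_flip_def)
            have cut: "weight \<omega> (cut_edges E \<chi>') = weight \<omega> E -
                weight \<omega> {e \<in> E - cut_edges E \<chi>. e \<inter> sv ` {..<m} = {}} -
                (\<Sum>i=1..c. class_cost w c i {j. j < m \<and> \<chi>' (sv j) = i})"
              if "coloring V c \<chi>'" "D_flip V \<chi> \<chi>' \<subseteq> S" for \<chi>'
              using that img SV
              by (intro weight_cut_edges[OF G inj _ \<kappa>S \<kappa>V w]) simp_all
            have "weight \<omega> (cut_edges E \<chi>'') \<le> weight \<omega> (cut_edges E out)"
              if "coloring V c \<chi>''" "D_flip V \<chi> \<chi>'' \<subseteq> S" for \<chi>''
            proof -
              have "\<forall>j<m. \<chi>'' (sv j) \<in> {1..c}"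
                using that(1) svV by (auto simp: coloring_def)
              then show ?thesis
                unfolding cut[OF that] cut[OF col_out flip_out] by (intro diff_left_mono opt)
            qed
            then show "good s5"
              using col_out flip_out unfolding good_def out_def by blast
          qed
        qed
      qed
    qed
  qed
  then show ?thesis
    using s(1) m(2) by (simp add: solve_def good_def[abs_def] d_def)
qed

text \<open>One program and one constant serve all instances. The expression in the bound vanishes
  for \<open>k = 0\<close>, and for the graph without vertices if \<open>c = 0\<close>, whereas
  every run takes at least one step; hence the \<open>max 1\<close>.\<close>

theorem theorem4:
  "\<exists>(P :: com) (C :: nat).
    \<forall>(V :: nat set) (E :: nat set set) (\<omega> :: nat set \<Rightarrow> rat) (c :: nat) (\<chi> :: nat \<Rightarrow> nat)
      (S :: nat set) (k :: nat) (s :: state).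
      graph V E \<longrightarrow> coloring V c \<chi> \<longrightarrow> S \<subseteq> V \<longrightarrow> card S \<le> k \<longrightarrow> encodes s V E \<omega> c \<chi> S \<longrightarrow>
      (\<exists>t s' \<chi>'. exec P s t s' \<and>
        t \<le> C * max 1 (3 ^ k * c * k\<^sup>2 + k * max_degree V E) \<and>
        \<chi>' = output_coloring s' \<and>
        coloring V c \<chi>' \<and>
        D_flip V \<chi> \<chi>' \<subseteq> S \<and>
        (\<forall>\<chi>''. coloring V c \<chi>'' \<and> D_flip V \<chi> \<chi>'' \<subseteq> S \<longrightarrow>
          weight \<omega> (cut_edges E \<chi>'') \<le> weight \<omega> (cut_edges E \<chi>')))"
proof (rule exI[of _ solve], rule exI[of _ 100], intro allI impI)
  fix V E \<omega> c \<chi> S k s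
  assume G: "graph V E" and col: "coloring V c \<chi>" and SV: "S \<subseteq> V" and k: "card S \<le> k"
    and enc: "encodes s V E \<omega> c \<chi> S"
  let ?T = "100 * max 1 (3 ^ k * c * k\<^sup>2 + k * max_degree V E)"
  have "runs solve s ?T (\<lambda>s'.
    coloring V c (output_coloring s') \<and> D_flip V \<chi> (output_coloring s') \<subseteq> S \<and>
    (\<forall>\<chi>''. coloring V c \<chi>'' \<and> D_flip V \<chi> \<chi>'' \<subseteq> S \<longrightarrow>
      weight \<omega> (cut_edges E \<chi>'') \<le> weight \<omega> (cut_edges E (output_coloring s'))))"
  proof (cases "S = {}")
    case True
    have same: "\<forall>v\<in>V. output_coloring s v = \<chi> v" and "nmem s ''size'' 0 = 0"
      using enc True by (simp_all add: encodes_def output_coloring_def)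
    \<comment> \<open>With \<open>S\<close> empty the admissible colorings coincide on
      \<open>V\<close>, so their cuts are equal and doing nothing is optimal.\<close>
    have cut_eq: "cut_edges E \<chi>'' = cut_edges E (output_coloring s)" if "D_flip V \<chi> \<chi>'' \<subseteq> {}" for \<chi>''
    proof -
      have "\<chi>'' v = output_coloring s v" if "v \<in> V" for v
        using same \<open>D_flip V \<chi> \<chi>'' \<subseteq> {}\<close> that by (auto simp: D_flip_def)
      then have "\<chi>'' u = output_coloring s u \<and> \<chi>'' v = output_coloring s v" if "{u, v} \<in> E" for u v
        using that G by (auto simp: graph_def)
      then show ?thesis unfolding cut_edges_def by (metis (no_types, lifting))
    qed
    \<comment> \<open>One step for the guard and one for \<open>Skip\<close>.\<close>
    have "runs solve s 2 (\<lambda>s'. s' = s)"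
      using \<open>nmem s ''size'' 0 = 0\<close> by (simp add: solve_def)
    then show ?thesis
    proof (rule runs_mono)
      show "2 \<le> ?T"
        by (rule order_trans[of _ "100 * 1"], simp) (intro mult_le_mono2 max.cobounded1)
      show "coloring V c (output_coloring s') \<and> D_flip V \<chi> (output_coloring s') \<subseteq> S \<and>
        (\<forall>\<chi>''. coloring V c \<chi>'' \<and> D_flip V \<chi> \<chi>'' \<subseteq> S \<longrightarrow>
          weight \<omega> (cut_edges E \<chi>'') \<le> weight \<omega> (cut_edges E (output_coloring s')))" if "s' = s" for s'
      proof (intro conjI allI impI)
        show "coloring V c (output_coloring s')" "D_flip V \<chi> (output_coloring s') \<subseteq> S"
          using col same that by (auto simp: coloring_def D_flip_def)
      qed (use cut_eq True that in simp)
    qed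
  next
    case False
    have "finite S" using G SV finite_subset by (auto simp: graph_def)
    then have m: "1 \<le> card S" using False by (simp add: Suc_le_eq card_gt_0_iff)
    obtain v where "v \<in> V" using False SV by blast
    then have c: "1 \<le> c" using col by (force simp: coloring_def)
    have "solve_time (card S) c (max_degree V E) + 1 \<le> ?T"
      using solve_time_le[OF m c k, of "max_degree V E"]
      by (rule order_trans) (intro mult_le_mono2 max.cobounded2)
    with runs_solve[OF G col SV enc refl m] show ?thesis
      by (rule runs_mono)
  qed
  then show "\<exists>t s' \<chi>'. exec solve s t s' \<and> t \<le> ?T \<and> \<chi>' = output_coloring s' \<and>
        coloring V c \<chi>' \<and> D_flip V \<chi> \<chi>' \<subseteq> S \<and>
        (\<forall>\<chi>''. coloring V c \<chi>'' \<and> D_flip V \<chi> \<chi>'' \<subseteq> S \<longrightarrow>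
          weight \<omega> (cut_edges E \<chi>'') \<le> weight \<omega> (cut_edges E \<chi>'))"
    unfolding runs_def by blast
qed

end
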